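(* For any $r\in(0,1)$ there is a sequence $\{v_m\}$ such that the rates $r_m$ of the extended BCH codes $\mathrm{eBCH}(v_m,m)$ satisfy $r_m\to r$ and the sequence $\{\mathrm{eBCH}(v_m,m)\}_m$ is capacity achieving on the BEC under bit-MAP decoding.
   Context: Let $\alpha$ be a primitive element of $\mathbb{F}_{2^m}$. For $1\le v\le 2^m-1$, let $f(m,v)$ be the lowest-degree polynomial over $\mathbb{F}_2$ having $\alpha,\alpha^2,\dots,\alpha^v$ as roots; $\mathrm{BCH}(v,m)$ is the binary cyclic code of length $2^m-1$ with generator polynomial $f(m,v)$ (primitive narrow-sense BCH code with designed distance $v+1$). $\mathrm{eBCH}(v,m)$ is the length-$2^m$ code obtained by appending to each codeword of $\mathrm{BCH}(v,m)$ an overall parity bit making the total weight even. A uniform codeword $\underline{X}$ is sent over $\mathrm{BEC}(p)$ (each bit independently erased with probability $p$) giving $\underline{Y}$; $P_b(p)=\frac1N\sum_i\Pr(X_i\text{ not uniquely determined by }\underline{Y})$. A sequence with rates $r_n\to r\in(0,1)$ is capacity achieving under bit-MAP decoding if $P_b^{(n)}(p)\to0$ for all $p\in[0,1-r)$. *)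

theory Defs
  imports "HOL-Analysis.Analysis" "HOL-Library.Z2"
    "HOL-Computational_Algebra.Polynomial" "HOL-Algebra.Ring"
begin

text \<open>F_2 is the type bit (HOL-Library.Z2). A finite field F_{2^m} is a HOL-Algebra
  field record R with 2^m elements.\<close>

definition eval_F2 :: "('a, 'b) ring_scheme \<Rightarrow> bit poly \<Rightarrow> 'a \<Rightarrow> 'a" where
  "eval_F2 R g x = (\<Oplus>\<^bsub>R\<^esub> i \<in> {..degree g}. (if coeff g i = 0 then \<zero>\<^bsub>R\<^esub> else x [^]\<^bsub>R\<^esub> i))"

definition primitive_elem :: "('a, 'b) ring_scheme \<Rightarrow> 'a \<Rightarrow> bool" where
  "primitive_elem R \<alpha> \<longleftrightarrow> \<alpha> \<in> carrier R \<and>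
     {\<alpha> [^]\<^bsub>R\<^esub> (k::nat) | k. True} = carrier R - {\<zero>\<^bsub>R\<^esub>}"

definition has_BCH_roots :: "('a, 'b) ring_scheme \<Rightarrow> 'a \<Rightarrow> nat \<Rightarrow> bit poly \<Rightarrow> bool" where
  "has_BCH_roots R \<alpha> v g \<longleftrightarrow> (\<forall>j\<in>{1..v}. eval_F2 R g (\<alpha> [^]\<^bsub>R\<^esub> j) = \<zero>\<^bsub>R\<^esub>)"

text \<open>f(m,v): the (nonzero) lowest-degree binary polynomial with roots alpha,...,alpha^v.
  Over F_2 every nonzero polynomial is monic, so this polynomial is unique.\<close>
definition BCH_gen :: "('a, 'b) ring_scheme \<Rightarrow> 'a \<Rightarrow> nat \<Rightarrow> bit poly" where
  "BCH_gen R \<alpha> v = (SOME g. g \<noteq> 0 \<and> has_BCH_roots R \<alpha> v g \<and>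
      (\<forall>h. h \<noteq> 0 \<and> has_BCH_roots R \<alpha> v h \<longrightarrow> degree g \<le> degree h))"

text \<open>BCH(v,m): cyclic code of length n = 2^m - 1 generated by f(m,v); codewords
  are the polynomials c of degree < n divisible by f(m,v), i.e. words (c_0,...,c_{n-1}).\<close>
definition BCH :: "('a, 'b) ring_scheme \<Rightarrow> 'a \<Rightarrow> nat \<Rightarrow> nat \<Rightarrow> bit poly set" where
  "BCH R \<alpha> v m = {c. degree c < 2^m - 1 \<and> BCH_gen R \<alpha> v dvd c}"

definition eBCH :: "('a, 'b) ring_scheme \<Rightarrow> 'a \<Rightarrow> nat \<Rightarrow> nat \<Rightarrow> (nat \<Rightarrow> bit) set" where
  "eBCH R \<alpha> v m = (\<lambda>c. (\<lambda>i. if i < 2^m - 1 then coeff c i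
                         else if i = 2^m - 1 then (\<Sum>j<2^m - 1. coeff c j) else 0)) ` BCH R \<alpha> v m"

definition code_rate :: "(nat \<Rightarrow> bit) set \<Rightarrow> nat \<Rightarrow> real" where
  "code_rate C N = log 2 (real (card C)) / real N"

definition erasure_prob :: "real \<Rightarrow> nat \<Rightarrow> nat set \<Rightarrow> real" where
  "erasure_prob p N E = p ^ card E * (1 - p) ^ (N - card E)"

definition bit_undetermined :: "(nat \<Rightarrow> bit) set \<Rightarrow> nat \<Rightarrow> nat set \<Rightarrow> (nat \<Rightarrow> bit) \<Rightarrow> nat \<Rightarrow> bool" where
  "bit_undetermined C N E x i \<longleftrightarrow>
     (\<exists>y\<in>C. (\<forall>j<N. j \<notin> E \<longrightarrow> y j = x j) \<and> y i \<noteq> x i)"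

definition bit_MAP_error :: "(nat \<Rightarrow> bit) set \<Rightarrow> nat \<Rightarrow> real \<Rightarrow> real" where
  "bit_MAP_error C N p = (1 / real N) * (\<Sum>i<N.
      (\<Sum>E\<in>Pow {..<N}. erasure_prob p N E *
         ((1 / real (card C)) * real (card {x\<in>C. bit_undetermined C N E x i}))))"

end

theory Submission
  imports Defs
begin

text \<open>
  Label the coordinates of the extended code by the elements of the field. Its words are those whose
  power moments of order \<open>0, \<dots>, v\<close> vanish, so the code is invariant under the affine maps
  \<open>x \<mapsto> a x + b\<close>, which act doubly transitively. Hence the probability \<open>h(t)\<close> that a bit
  is not determined by the others, each erased with probability \<open>t\<close>, is the same for all bits, and
  all the influences on it are equal. The expected dimension of the subcode supported on the
  erasures has derivative \<open>N h\<close>, which gives \<open>h(q) \<le> rate / (1 - q)\<close>. A variance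
  inequality of Falik and Samorodnitsky, obtained from a logarithmic Sobolev inequality on the biased
  cube, forces the slope of \<open>h\<close> to infinity wherever \<open>h\<close> stays away from \<open>0\<close> and
  \<open>1\<close>, so \<open>h\<close> must already be small to the left of \<open>1 - r\<close>. The rate is tuned through
  \<open>v\<close>, since one further moment costs at most \<open>m\<close> dimensions.
\<close>

section \<open>Influences on the biased cube\<close>

text \<open>The expectation of \<open>g\<close> over a random set that contains each of the first
  \<open>M\<close> indices independently with probability \<open>t\<close>. Splitting on the last
  index prepares the inductions over coordinates below.\<close>

primrec cube_avg :: "real \<Rightarrow> nat \<Rightarrow> (nat set \<Rightarrow> real) \<Rightarrow> real" where
  "cube_avg t 0 g = g {}"
| "cube_avg t (Suc M) g = (1 - t) * cube_avg t M g + t * cube_avg t M (\<lambda>E. g (insert M E))"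

definition flip_diff :: "nat \<Rightarrow> (nat set \<Rightarrow> real) \<Rightarrow> nat set \<Rightarrow> real" where
  "flip_diff j g E = g (insert j E) - g (E - {j})"

text \<open>The Dirichlet form. Given the other coordinates, \<open>g\<close> takes two values that
  differ by \<open>flip_diff j g E\<close>, so its conditional variance in direction
  \<open>j\<close> is \<open>t * (1 - t)\<close> times the square of that difference.\<close>

definition energy :: "real \<Rightarrow> nat \<Rightarrow> (nat set \<Rightarrow> real) \<Rightarrow> real" where
  "energy t M g = t * (1 - t) * (\<Sum>j<M. cube_avg t M (\<lambda>E. (flip_diff j g E)\<^sup>2))"

lemma cube_avg_cong:
  assumes "\<And>E. E \<subseteq> {..<M} \<Longrightarrow> f E = g E"
  shows "cube_avg t M f = cube_avg t M g"
  using assms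
proof (induction M arbitrary: f g)
  case (Suc M)
  have "cube_avg t M f = cube_avg t M g"
    by (rule Suc.IH) (use Suc.prems in \<open>auto simp: lessThan_Suc\<close>)
  moreover have "cube_avg t M (\<lambda>E. f (insert M E)) = cube_avg t M (\<lambda>E. g (insert M E))"
    by (intro Suc.IH Suc.prems) auto
  ultimately show ?case by simp
qed simp

lemma cube_avg_add: "cube_avg t M (\<lambda>E. f E + g E) = cube_avg t M f + cube_avg t M g"
  by (induction M arbitrary: f g) (simp_all add: algebra_simps)

lemma cube_avg_mult: "cube_avg t M (\<lambda>E. c * f E) = c * cube_avg t M f"
  by (induction M arbitrary: f) (simp_all add: algebra_simps)

lemma cube_avg_diff: "cube_avg t M (\<lambda>E. f E - g E) = cube_avg t M f - cube_avg t M g"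
  using cube_avg_add[of t M f "\<lambda>E. - 1 * g E"] unfolding cube_avg_mult by simp

lemma cube_avg_const: "cube_avg t M (\<lambda>E. c) = c"
  by (induction M) (simp_all add: algebra_simps)

lemma cube_avg_mono:
  assumes "0 \<le> t" "t \<le> 1" "\<And>E. E \<subseteq> {..<M} \<Longrightarrow> f E \<le> g E"
  shows "cube_avg t M f \<le> cube_avg t M g"
  using assms(3)
proof (induction M arbitrary: f g)
  case (Suc M)
  have "cube_avg t M f \<le> cube_avg t M g"
    by (rule Suc.IH) (use Suc.prems in \<open>auto simp: lessThan_Suc\<close>)
  moreover have "cube_avg t M (\<lambda>E. f (insert M E)) \<le> cube_avg t M (\<lambda>E. g (insert M E))"
    by (intro Suc.IH Suc.prems) auto
  ultimately show ?case using assms(1,2) by (simp add: add_mono mult_left_mono)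
qed simp

lemma cube_avg_nonneg:
  assumes "0 \<le> t" "t \<le> 1" "\<And>E. 0 \<le> f E"
  shows "0 \<le> cube_avg t M f"
  using cube_avg_mono[OF assms(1,2), of M "\<lambda>_. 0" f] assms(3) by (simp add: cube_avg_const)

text \<open>The weights are those of \<open>erasure_prob\<close>, which ties the recursion to the
  channel; this form also gives permutation invariance and Cauchy-Schwarz.\<close>

lemma cube_avg_eq_sum:
  "cube_avg t M g = (\<Sum>E\<in>Pow {..<M}. t ^ card E * (1 - t) ^ (M - card E) * g E)"
proof (induction M arbitrary: g)
  case (Suc M)
  have fin: "finite E" and le: "card E \<le> M" and nin: "M \<notin> E" if "E \<in> Pow {..<M}" for E
    using that finite_subset[of E "{..<M}"] card_mono[of "{..<M}" E] by auto
  have disj: "Pow {..<M} \<inter> insert M ` Pow {..<M} = {}" by auto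
  have inj: "inj_on (insert M) (Pow {..<M})"
    by (rule inj_onI) (metis insert_ident nin)
  have "(\<Sum>E\<in>Pow {..<Suc M}. t ^ card E * (1 - t) ^ (Suc M - card E) * g E)
      = (\<Sum>E\<in>Pow {..<M}. t ^ card E * (1 - t) ^ (Suc M - card E) * g E)
        + (\<Sum>E\<in>insert M ` Pow {..<M}. t ^ card E * (1 - t) ^ (Suc M - card E) * g E)"
    unfolding lessThan_Suc Pow_insert by (rule sum.union_disjoint) (use disj in auto)
  also have "(\<Sum>E\<in>Pow {..<M}. t ^ card E * (1 - t) ^ (Suc M - card E) * g E)
      = (1 - t) * cube_avg t M g"
    unfolding Suc.IH sum_distrib_left
    by (rule sum.cong) (use le in \<open>auto simp: Suc_diff_le\<close>)
  also have "(\<Sum>E\<in>insert M ` Pow {..<M}. t ^ card E * (1 - t) ^ (Suc M - card E) * g E)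
      = t * cube_avg t M (\<lambda>E. g (insert M E))"
    unfolding Suc.IH sum_distrib_left sum.reindex[OF inj]
    by (rule sum.cong) (use fin nin in \<open>auto simp: mult.assoc\<close>)
  finally show ?case by simp
qed simp

lemma cube_avg_permute:
  assumes "\<pi> permutes {..<M}"
  shows "cube_avg t M (\<lambda>E. g (\<pi> ` E)) = cube_avg t M g"
proof -
  have inj: "inj \<pi>" using assms permutes_inj by blast
  have "bij_betw ((`) \<pi>) (Pow {..<M}) (Pow {..<M})"
    by (rule bij_betw_Pow) (rule permutes_imp_bij[OF assms])
  from sum.reindex_bij_betw[OF this, of "\<lambda>E. t ^ card E * (1 - t) ^ (M - card E) * g E"]
  show ?thesis
    unfolding cube_avg_eq_sum by (simp add: card_image[OF inj_on_subset[OF inj]])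
qed

lemma cube_avg_Cauchy_Schwarz:
  assumes "0 \<le> t" "t \<le> 1"
  shows "(cube_avg t M (\<lambda>E. f E * g E))\<^sup>2
     \<le> cube_avg t M (\<lambda>E. (f E)\<^sup>2) * cube_avg t M (\<lambda>E. (g E)\<^sup>2)"
proof -
  \<comment> \<open>The square root of the weight goes into both factors, so that the unweighted
    inequality applies.\<close>
  define w where "w E = sqrt (t ^ card E * (1 - t) ^ (M - card E))" for E :: "nat set"
  have w: "(w E)\<^sup>2 = t ^ card E * (1 - t) ^ (M - card E)" for E
    unfolding w_def using assms by (simp add: real_sqrt_pow2)
  have *: "cube_avg t M h = (\<Sum>E\<in>Pow {..<M}. (w E)\<^sup>2 * h E)" for h
    unfolding cube_avg_eq_sum w ..
  show ?thesis
    using Cauchy_Schwarz_ineq_sum[of "\<lambda>E. w E * f E" "\<lambda>E. w E * g E" "Pow {..<M}"]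
    unfolding * by (simp add: power_mult_distrib power2_eq_square mult_ac)
qed

text \<open>The function \<open>k\<close> is left open to cover the differences themselves, their
  squares and their absolute values.\<close>

lemma cube_avg_flip_diff_Suc:
  assumes "j < M"
  shows "cube_avg t (Suc M) (\<lambda>E. k (flip_diff j g E))
    = (1 - t) * cube_avg t M (\<lambda>E. k (flip_diff j g E))
      + t * cube_avg t M (\<lambda>E. k (flip_diff j (\<lambda>E. g (insert M E)) E))"
proof -
  have "insert j (insert M E) = insert M (insert j E)" "insert M E - {j} = insert M (E - {j})" for E
    using assms by auto
  then show ?thesis by (simp add: flip_diff_def)
qed

lemma cube_avg_flip_diff_last:
  "cube_avg t (Suc M) (\<lambda>E. k (flip_diff M g E)) = cube_avg t M (\<lambda>E. k (g (insert M E) - g E))"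
proof -
  have "cube_avg t M (\<lambda>E. k (flip_diff M g E)) = cube_avg t M (\<lambda>E. k (g (insert M E) - g E))"
    "cube_avg t M (\<lambda>E. k (flip_diff M g (insert M E))) = cube_avg t M (\<lambda>E. k (g (insert M E) - g E))"
    by (rule cube_avg_cong; subgoal_tac "M \<notin> E"; force simp: flip_diff_def)+
  then show ?thesis by (simp add: algebra_simps)
qed

lemma energy_Suc:
  "energy t (Suc M) g = (1 - t) * energy t M g + t * energy t M (\<lambda>E. g (insert M E))
     + t * (1 - t) * cube_avg t M (\<lambda>E. (g (insert M E) - g E)\<^sup>2)"
proof -
  have "(\<Sum>j<M. cube_avg t (Suc M) (\<lambda>E. (flip_diff j g E)\<^sup>2))
      = (\<Sum>j<M. (1 - t) * cube_avg t M (\<lambda>E. (flip_diff j g E)\<^sup>2)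
          + t * cube_avg t M (\<lambda>E. (flip_diff j (\<lambda>E. g (insert M E)) E)\<^sup>2))"
    by (rule sum.cong) (auto simp: cube_avg_flip_diff_Suc[where k="\<lambda>x. x\<^sup>2"] simp del: cube_avg.simps)
  then show ?thesis
    unfolding energy_def sum.lessThan_Suc cube_avg_flip_diff_last[where k="\<lambda>x. x\<^sup>2"]
    by (simp only: sum.distrib sum_distrib_left[symmetric]) (simp only: algebra_simps)
qed

lemma energy_nonneg: "0 \<le> t \<Longrightarrow> t \<le> 1 \<Longrightarrow> 0 \<le> energy t M g"
  unfolding energy_def by (intro mult_nonneg_nonneg sum_nonneg cube_avg_nonneg) auto

text \<open>Russo's formula. The product rule along the recursion averages the slopes of the two
  halves and adds the gap between their means, which is the mean difference in the last
  coordinate.\<close>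

lemma cube_avg_has_derivative:
  "((\<lambda>t. cube_avg t M g) has_real_derivative (\<Sum>j<M. cube_avg t M (flip_diff j g))) (at t)"
proof (induction M arbitrary: g)
  case (Suc M)
  let ?g1 = "\<lambda>E. g (insert M E)"
  have "(\<Sum>j<Suc M. cube_avg t (Suc M) (flip_diff j g))
     = (1 - t) * (\<Sum>j<M. cube_avg t M (flip_diff j g)) + t * (\<Sum>j<M. cube_avg t M (flip_diff j ?g1))
       + (cube_avg t M ?g1 - cube_avg t M g)"
    using cube_avg_flip_diff_Suc[where k="\<lambda>x. x" and t=t and M=M and g=g]
      cube_avg_flip_diff_last[where k="\<lambda>x. x" and t=t and M=M and g=g]
    by (simp add: sum.distrib sum_distrib_left cube_avg_diff del: cube_avg.simps)
  moreover have "((\<lambda>t. cube_avg t (Suc M) g) has_real_derivative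
     ((1 - t) * (\<Sum>j<M. cube_avg t M (flip_diff j g)) + (-1) * cube_avg t M g
      + (t * (\<Sum>j<M. cube_avg t M (flip_diff j ?g1)) + 1 * cube_avg t M ?g1))) (at t)"
    unfolding cube_avg.simps
    by (rule derivative_eq_intros Suc.IH refl | simp)+
  moreover have "(1 - t) * x + (-1) * c + (t * y + 1 * d) = (1 - t) * x + t * y + (d - c)"
    for x y c d :: real by simp
  ultimately show ?case by (simp only:)
qed simp

section \<open>A logarithmic Sobolev inequality on the biased cube\<close>

lemma log_sobolev_step:
  fixes t a0 a1 b0 b1 x :: real
  assumes t: "0 < t" "t < 1"
    and a: "0 \<le> a0" "0 \<le> a1" and b: "0 \<le> b0" "0 \<le> b1"
    and pos: "a0 > 0 \<Longrightarrow> b0 > 0" "a1 > 0 \<Longrightarrow> b1 > 0"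
    and x: "(a1 - a0)\<^sup>2 \<le> x * (2 * (a0 + a1))" "0 \<le> x"
  defines "a \<equiv> (1 - t) * a0 + t * a1" and "b \<equiv> (1 - t) * b0 + t * b1"
  shows "a * ln (a / b\<^sup>2) \<le> (1 - t) * (a0 * ln (a0 / b0\<^sup>2)) + t * (a1 * ln (a1 / b1\<^sup>2))
            + 2 / min t (1 - t) * (t * (1 - t) * x)"
proof (cases "a = 0")
  case True
  then have "a0 = 0" "a1 = 0"
    using t a unfolding a_def by (auto simp: add_nonneg_eq_0_iff)
  then show ?thesis using True x t by simp
next
  case False
  then have apos: "a > 0" using t a unfolding a_def by (simp add: order_less_le)
  then have bpos: "b > 0"
  proof (cases "a0 > 0")
    case True
    then show ?thesis using t b pos unfolding b_def by (intro add_pos_nonneg) auto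
  next
    case False
    then have "a1 > 0" using apos a t unfolding a_def by (cases "a1 = 0") auto
    then show ?thesis using t b pos unfolding b_def by (intro add_nonneg_pos) auto
  qed
  have bound: "u * ln (a / b\<^sup>2) - u * ln (u / w\<^sup>2) \<le> 2 * (a * w / b - u) + (u\<^sup>2 / a - u)"
    if "0 \<le> u" "0 \<le> w" "u > 0 \<Longrightarrow> w > 0" for u w
  proof (cases "u = 0")
    case True
    then show ?thesis using apos bpos that by simp
  next
    case False
    then have u: "u > 0" and w: "w > 0" using that by auto
    \<comment> \<open>The logarithm is split in this way so that, after ln y \<le> y - 1 and
      averaging over the two halves, the first terms cancel and the second leave the variance of the
      pair \<open>a0\<close>, \<open>a1\<close> divided by \<open>a\<close>.\<close>
    have "ln (a / b\<^sup>2) - ln (u / w\<^sup>2) = 2 * ln (a * w / (u * b)) + ln (u / a)"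
      using u w apos bpos by (simp add: ln_div ln_mult ln_realpow)
    also have "\<dots> \<le> 2 * (a * w / (u * b) - 1) + (u / a - 1)"
      using u w apos bpos by (intro add_mono mult_left_mono ln_le_minus_one) auto
    finally have "u * (ln (a / b\<^sup>2) - ln (u / w\<^sup>2)) \<le> u * (2 * (a * w / (u * b) - 1) + (u / a - 1))"
      using u by (intro mult_left_mono) auto
    also have "\<dots> = 2 * (a * w / b - u) + (u\<^sup>2 / a - u)"
      using u by (simp add: field_simps power2_eq_square)
    finally show ?thesis by (simp add: algebra_simps)
  qed
  have "a * ln (a / b\<^sup>2) - ((1 - t) * (a0 * ln (a0 / b0\<^sup>2)) + t * (a1 * ln (a1 / b1\<^sup>2)))
     = (1 - t) * (a0 * ln (a / b\<^sup>2) - a0 * ln (a0 / b0\<^sup>2)) + t * (a1 * ln (a / b\<^sup>2) - a1 * ln (a1 / b1\<^sup>2))"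
    unfolding a_def by (simp add: algebra_simps)
  also have "\<dots> \<le> (1 - t) * (2 * (a * b0 / b - a0) + (a0\<^sup>2 / a - a0)) + t * (2 * (a * b1 / b - a1) + (a1\<^sup>2 / a - a1))"
    using t a b pos by (intro add_mono mult_left_mono bound) auto
  also have "\<dots> = 2 * (a * ((1 - t) * b0 + t * b1) / b - ((1 - t) * a0 + t * a1))
        + (((1 - t) * a0\<^sup>2 + t * a1\<^sup>2) / a - ((1 - t) * a0 + t * a1))"
    by (simp add: algebra_simps add_divide_distrib diff_divide_distrib)
  also have "\<dots> = ((1 - t) * a0\<^sup>2 + t * a1\<^sup>2 - a\<^sup>2) / a"
    unfolding b_def[symmetric] a_def[symmetric] using bpos apos
    by (simp add: field_simps power2_eq_square)
  also have "(1 - t) * a0\<^sup>2 + t * a1\<^sup>2 - a\<^sup>2 = t * (1 - t) * (a1 - a0)\<^sup>2"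
    unfolding a_def by (simp add: algebra_simps power2_eq_square)
  also have "t * (1 - t) * (a1 - a0)\<^sup>2 / a \<le> 2 / min t (1 - t) * (t * (1 - t) * x)"
  proof -
    have m: "min t (1 - t) > 0" using t by auto
    \<comment> \<open>Both halves have weight at least \<open>min t (1 - t)\<close>, whence the
      denominator of the constant; its factor 2 is inherited from the hypothesis on
      \<open>x\<close>.\<close>
    have "min t (1 - t) * (a0 + a1) \<le> a"
      unfolding a_def using a by (simp add: distrib_left add_mono mult_right_mono)
    then have "a0 + a1 \<le> a / min t (1 - t)" using m by (simp add: field_simps)
    then have "x * (2 * (a0 + a1)) \<le> x * (2 * (a / min t (1 - t)))"
      using x(2) by (intro mult_left_mono) auto
    then have "(a1 - a0)\<^sup>2 \<le> x * (2 * (a / min t (1 - t)))" using x(1) by linarith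
    then have "(a1 - a0)\<^sup>2 / a \<le> x * 2 / min t (1 - t)"
      using apos by (simp add: field_simps)
    then have "t * (1 - t) * ((a1 - a0)\<^sup>2 / a) \<le> t * (1 - t) * (x * 2 / min t (1 - t))"
      using t by (intro mult_left_mono) auto
    then show ?thesis by (simp add: mult_ac)
  qed
  finally show ?thesis by simp
qed

text \<open>For 0 < t < 1 every set has positive weight, so both averages vanish only together. This
  keeps the denominator in \<open>log_sobolev\<close> positive whenever the numerator is.\<close>

lemma cube_avg_square_pos_imp_abs_pos:
  assumes "0 < t" "t < 1" "0 < cube_avg t M (\<lambda>E. (g E)\<^sup>2)"
  shows "0 < cube_avg t M (\<lambda>E. \<bar>g E\<bar>)"
  using assms(3)
proof (induction M arbitrary: g)
  case (Suc M)
  have nn: "0 \<le> cube_avg t M (\<lambda>E. \<bar>h E\<bar>)" "0 \<le> cube_avg t M (\<lambda>E. (h E)\<^sup>2)" for h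
    using assms(1,2) by (auto intro!: cube_avg_nonneg)
  from Suc.prems have "0 < cube_avg t M (\<lambda>E. (g E)\<^sup>2) \<or> 0 < cube_avg t M (\<lambda>E. (g (insert M E))\<^sup>2)"
    using nn(2)[of g] nn(2)[of "\<lambda>E. g (insert M E)"] by (force simp: order_less_le)
  then have "0 < cube_avg t M (\<lambda>E. \<bar>g E\<bar>) \<or> 0 < cube_avg t M (\<lambda>E. \<bar>g (insert M E)\<bar>)"
    using Suc.IH[of g] Suc.IH[of "\<lambda>E. g (insert M E)"] by blast
  then show ?case
    using nn(1)[of g] nn(1)[of "\<lambda>E. g (insert M E)"] assms(1,2)
    by (auto intro: add_pos_nonneg add_nonneg_pos)
qed auto

text \<open>By Jensen's inequality the left side is a lower bound for the entropy of the square of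
  \<open>g\<close>. Being a function of two moments only, it can be followed through the induction
  without the entropy itself.\<close>

lemma log_sobolev:
  assumes t: "0 < t" "t < 1"
  shows "cube_avg t M (\<lambda>E. (g E)\<^sup>2) * ln (cube_avg t M (\<lambda>E. (g E)\<^sup>2) / (cube_avg t M (\<lambda>E. \<bar>g E\<bar>))\<^sup>2)
     \<le> 2 / min t (1 - t) * energy t M g"
proof (induction M arbitrary: g)
  case 0
  then show ?case by (simp add: energy_def)
next
  case (Suc M)
  define g1 where "g1 = (\<lambda>E. g (insert M E))"
  define C where "C = 2 / min t (1 - t)"
  define A where "A h = cube_avg t M (\<lambda>E. (h E)\<^sup>2)" for h
  define B where "B h = cube_avg t M (\<lambda>E. \<bar>h E\<bar>)" for h
  define x where "x = A (\<lambda>E. g1 E - g E)"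
  have t': "0 \<le> t" "t \<le> 1" using t by auto
  have nn: "0 \<le> A h" "0 \<le> B h" for h
    unfolding A_def B_def using t' by (auto intro!: cube_avg_nonneg)
  \<comment> \<open>The difference of squares factors, so Cauchy-Schwarz bounds the gap between the
    two second moments by means of \<open>x\<close>, which times \<open>t * (1 - t)\<close> is the
    last coordinate's share of the energy.\<close>
  have "(A g1 - A g)\<^sup>2 = (cube_avg t M (\<lambda>E. (g1 E - g E) * (g1 E + g E)))\<^sup>2"
    unfolding A_def cube_avg_diff[symmetric] by (simp add: algebra_simps power2_eq_square)
  also have "\<dots> \<le> x * A (\<lambda>E. g1 E + g E)"
    unfolding x_def A_def by (rule cube_avg_Cauchy_Schwarz[OF t'])
  also have "A (\<lambda>E. g1 E + g E) \<le> 2 * (A g + A g1)"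
    unfolding A_def cube_avg_add[symmetric] cube_avg_mult[symmetric]
    by (rule cube_avg_mono[OF t']) (simp add: power2_sum, metis add.commute sum_squares_bound)
  then have "x * A (\<lambda>E. g1 E + g E) \<le> x * (2 * (A g + A g1))"
    using nn unfolding x_def by (intro mult_left_mono) auto
  finally have x: "(A g1 - A g)\<^sup>2 \<le> x * (2 * (A g + A g1))" .
  have "((1 - t) * A g + t * A g1) * ln (((1 - t) * A g + t * A g1) / ((1 - t) * B g + t * B g1)\<^sup>2)
    \<le> (1 - t) * (A g * ln (A g / (B g)\<^sup>2)) + t * (A g1 * ln (A g1 / (B g1)\<^sup>2))
       + C * (t * (1 - t) * x)"
    unfolding C_def using nn x cube_avg_square_pos_imp_abs_pos[OF t, of M]
    by (intro log_sobolev_step t) (auto simp: x_def A_def B_def)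
  also have "\<dots> \<le> (1 - t) * (C * energy t M g) + t * (C * energy t M g1) + C * (t * (1 - t) * x)"
    using t Suc.IH unfolding C_def A_def B_def by (intro add_mono mult_left_mono) auto
  also have "\<dots> = C * energy t (Suc M) g"
    unfolding energy_Suc x_def A_def g1_def by (simp add: algebra_simps)
  finally show ?case by (simp add: A_def B_def g1_def C_def)
qed

text \<open>The logarithm is replaced by a tangent line with free slope parameter \<open>s\<close>.
  The resulting bound is linear in the second moment, so it can be summed over martingale
  differences term by term.\<close>

lemma log_sobolev_linear:
  assumes t: "0 < t" "t < 1"
  shows "s * cube_avg t M (\<lambda>E. (g E)\<^sup>2)
     \<le> 2 / min t (1 - t) * energy t M g + exp s * (cube_avg t M (\<lambda>E. \<bar>g E\<bar>))\<^sup>2"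
proof -
  define a where "a = cube_avg t M (\<lambda>E. (g E)\<^sup>2)"
  define b where "b = cube_avg t M (\<lambda>E. \<bar>g E\<bar>)"
  have a: "0 \<le> a" unfolding a_def using t by (auto intro!: cube_avg_nonneg)
  have E: "0 \<le> 2 / min t (1 - t) * energy t M g"
    using t energy_nonneg[of t M g] by auto
  show ?thesis
  proof (cases "a = 0")
    case True
    then show ?thesis using E unfolding a_def by simp
  next
    case False
    then have a: "a > 0" using a by simp
    have b: "b > 0" using cube_avg_square_pos_imp_abs_pos[OF t] a unfolding a_def b_def by blast
    have "ln (exp s * b\<^sup>2 / a) \<le> exp s * b\<^sup>2 / a - 1"
      using a b by (intro ln_le_minus_one) auto
    moreover have "ln (exp s * b\<^sup>2 / a) = s - ln (a / b\<^sup>2)"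
      using a b by (simp add: ln_div ln_mult)
    ultimately have "a * (s - ln (a / b\<^sup>2)) \<le> a * (exp s * b\<^sup>2 / a)"
      using a by (intro mult_left_mono) auto
    then have "s * a \<le> a * ln (a / b\<^sup>2) + exp s * b\<^sup>2"
      using a by (simp add: algebra_simps)
    then show ?thesis using log_sobolev[OF t, of M g] unfolding a_def b_def by linarith
  qed
qed

section \<open>Variance against energy and influences\<close>

definition cube_var :: "real \<Rightarrow> nat \<Rightarrow> (nat set \<Rightarrow> real) \<Rightarrow> real" where
  "cube_var t M f = cube_avg t M (\<lambda>E. (f E)\<^sup>2) - (cube_avg t M f)\<^sup>2"

text \<open>Revealing the coordinates one at a time splits variance and energy simultaneously into
  martingale differences, and the logarithmic Sobolev inequality is applied to each of them.\<close>

theorem falik_samorodnitsky: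
  assumes t: "0 < t" "t < 1"
  shows "s * cube_var t M f \<le> 2 / min t (1 - t) * energy t M f
            + exp s * (\<Sum>j<M. (cube_avg t M (\<lambda>E. \<bar>flip_diff j f E\<bar>))\<^sup>2)"
proof (induction M arbitrary: f)
  case 0
  then show ?case by (simp add: cube_var_def energy_def)
next
  case (Suc M)
  have t': "0 \<le> t" "t \<le> 1" using t by auto
  define C where "C = 2 / min t (1 - t)"
  have C: "C \<ge> 0" unfolding C_def using t by auto
  define f1 where "f1 = (\<lambda>E. f (insert M E))"
  \<comment> \<open>Below, \<open>m\<close> is \<open>f\<close> with the last coordinate averaged
    out. The martingale difference \<open>f - m\<close> is \<open>- t * D\<close> on one half and
    \<open>(1 - t) * D\<close> on the other, so its second moment is \<open>t * (1 - t)\<close>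
    times that of \<open>D\<close>.\<close>
  define D where "D = (\<lambda>E. f1 E - f E)"
  define m where "m = (\<lambda>E. (1 - t) * f E + t * f1 E)"
  define A where "A h = cube_avg t M (\<lambda>E. (h E)\<^sup>2)" for h
  define J where "J j h = cube_avg t M (\<lambda>E. \<bar>flip_diff j h E\<bar>)" for j h
  define b where "b = cube_avg t M (\<lambda>E. \<bar>D E\<bar>)"
  have sq: "(1 - t) * A u + t * A w
      = A (\<lambda>E. (1 - t) * u E + t * w E) + t * (1 - t) * A (\<lambda>E. w E - u E)" for u w
    unfolding A_def cube_avg_mult[symmetric] cube_avg_add[symmetric]
    by (rule cube_avg_cong) (simp add: algebra_simps power2_eq_square)
  have var: "cube_var t (Suc M) f = cube_var t M m + t * (1 - t) * A D"
  proof -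
    have "cube_avg t M m = (1 - t) * cube_avg t M f + t * cube_avg t M f1"
      unfolding m_def by (simp add: cube_avg_add cube_avg_mult)
    then show ?thesis
      using sq[of f f1] unfolding cube_var_def by (simp add: A_def m_def D_def f1_def)
  qed
  have en: "(1 - t) * energy t M f + t * energy t M f1 = energy t M m + t * (1 - t) * energy t M D"
  proof -
    have *: "(1 - t) * A (flip_diff j f) + t * A (flip_diff j f1)
       = A (flip_diff j m) + t * (1 - t) * A (flip_diff j D)" for j
      using sq[of "flip_diff j f" "flip_diff j f1"]
      by (simp add: flip_diff_def[abs_def] m_def D_def algebra_simps)
    have e: "energy t M h = t * (1 - t) * (\<Sum>j<M. A (flip_diff j h))" for h
      by (simp add: energy_def A_def)
    have "(1 - t) * (\<Sum>j<M. A (flip_diff j f)) + t * (\<Sum>j<M. A (flip_diff j f1))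
        = (\<Sum>j<M. A (flip_diff j m)) + t * (1 - t) * (\<Sum>j<M. A (flip_diff j D))"
      unfolding sum_distrib_left sum.distrib[symmetric] * ..
    from arg_cong[OF this, of "\<lambda>x. t * (1 - t) * x"] show ?thesis
      unfolding e distrib_left by (simp only: mult_ac)
  qed
  \<comment> \<open>By the triangle inequality, averaging out one coordinate cannot increase the
    absolute influences of the others.\<close>
  have J: "(J j m)\<^sup>2 \<le> (cube_avg t (Suc M) (\<lambda>E. \<bar>flip_diff j f E\<bar>))\<^sup>2" if "j < M" for j
  proof (rule power_mono)
    have "J j m \<le> (1 - t) * J j f + t * J j f1"
      unfolding J_def cube_avg_mult[symmetric] cube_avg_add[symmetric]
    proof (rule cube_avg_mono[OF t'])
      fix E
      have "flip_diff j m E = (1 - t) * flip_diff j f E + t * flip_diff j f1 E"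
        by (simp add: flip_diff_def m_def algebra_simps)
      then show "\<bar>flip_diff j m E\<bar> \<le> (1 - t) * \<bar>flip_diff j f E\<bar> + t * \<bar>flip_diff j f1 E\<bar>"
        using t' by (metis abs_mult abs_of_nonneg abs_triangle_ineq diff_ge_0_iff_ge)
    qed
    then show "J j m \<le> cube_avg t (Suc M) (\<lambda>E. \<bar>flip_diff j f E\<bar>)"
      unfolding cube_avg_flip_diff_Suc[OF that, where k=abs] J_def f1_def .
    show "0 \<le> J j m" unfolding J_def using t' by (intro cube_avg_nonneg) auto
  qed
  have "s * cube_var t (Suc M) f = s * cube_var t M m + t * (1 - t) * (s * A D)"
    unfolding var by (simp add: algebra_simps)
  \<comment> \<open>The induction hypothesis treats \<open>m\<close>; the logarithmic Sobolev
    inequality treats \<open>D\<close>, whose first absolute moment \<open>b\<close> is the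
    influence of the last coordinate.\<close>
  also have "\<dots> \<le> (C * energy t M m + exp s * (\<Sum>j<M. (J j m)\<^sup>2))
      + t * (1 - t) * (C * energy t M D + exp s * b\<^sup>2)"
    using t log_sobolev_linear[OF t, of s M D] Suc.IH[of m]
    unfolding C_def A_def J_def b_def by (intro add_mono mult_left_mono) auto
  also have "\<dots> = C * ((1 - t) * energy t M f + t * energy t M f1)
      + exp s * ((\<Sum>j<M. (J j m)\<^sup>2) + t * (1 - t) * b\<^sup>2)"
    unfolding en by (simp add: algebra_simps)
  also have "\<dots> \<le> C * energy t (Suc M) f
      + exp s * ((\<Sum>j<M. (cube_avg t (Suc M) (\<lambda>E. \<bar>flip_diff j f E\<bar>))\<^sup>2)
          + (cube_avg t (Suc M) (\<lambda>E. \<bar>flip_diff M f E\<bar>))\<^sup>2)"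
  proof (intro add_mono mult_left_mono sum_mono C)
    show "(1 - t) * energy t M f + t * energy t M f1 \<le> energy t (Suc M) f"
      unfolding energy_Suc f1_def using t' by (auto intro!: mult_nonneg_nonneg cube_avg_nonneg)
    have "t * (1 - t) \<le> 1" using t' mult_mono[of t 1 "1 - t" 1] by auto
    then have "t * (1 - t) * b\<^sup>2 \<le> b\<^sup>2" by (simp add: mult_left_le_one_le t' )
    then show "t * (1 - t) * b\<^sup>2 \<le> (cube_avg t (Suc M) (\<lambda>E. \<bar>flip_diff M f E\<bar>))\<^sup>2"
      unfolding cube_avg_flip_diff_last[where k=abs] b_def D_def f1_def .
  qed (use J in auto)
  finally show ?case unfolding C_def by (simp del: cube_avg.simps)
qed

section \<open>Linear codes on the erasure channel\<close>

lemma bit_add_self: "(a::bit) + a = 0"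
  by simp

lemma bit_add_cancel_right: "(a::bit) + b + b = a"
  by (simp only: add.assoc bit_add_self add_0_right)

lemma bit_add_eq_0_iff: "(a::bit) + b = 0 \<longleftrightarrow> a = b"
  by (metis add_0_left bit_add_cancel_right bit_add_self)

locale binary_linear_code =
  fixes C :: "(nat \<Rightarrow> bit) set" and N :: nat
  assumes length: "c \<in> C \<Longrightarrow> N \<le> i \<Longrightarrow> c i = 0"
    and zero: "(\<lambda>_. 0) \<in> C"
    and add: "c \<in> C \<Longrightarrow> d \<in> C \<Longrightarrow> (\<lambda>i. c i + d i) \<in> C"

text \<open>By linearity these are the differences of codewords that agree outside \<open>E\<close>,
  so they measure exactly the ambiguity left when \<open>E\<close> is erased.\<close>

definition shortened :: "(nat \<Rightarrow> bit) set \<Rightarrow> nat set \<Rightarrow> (nat \<Rightarrow> bit) set" where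
  "shortened C E = {c \<in> C. \<forall>j. j \<notin> E \<longrightarrow> c j = 0}"

text \<open>The extrinsic event: bit \<open>i\<close> is not determined by the unerased bits other than \<open>i\<close>.\<close>
definition exit_ind :: "(nat \<Rightarrow> bit) set \<Rightarrow> nat \<Rightarrow> nat set \<Rightarrow> real" where
  "exit_ind C i E = of_bool (\<exists>y \<in> shortened C (insert i E). y i = 1)"

definition code_automorphism :: "(nat \<Rightarrow> bit) set \<Rightarrow> nat \<Rightarrow> (nat \<Rightarrow> nat) \<Rightarrow> bool" where
  "code_automorphism C N \<pi> \<longleftrightarrow> \<pi> permutes {..<N} \<and> (\<forall>c. c \<circ> \<pi> \<in> C \<longleftrightarrow> c \<in> C)"

lemma words_bij_Pow:
  "bij_betw (\<lambda>c. {i. c i = 1}) {c :: nat \<Rightarrow> bit. \<forall>i\<ge>N. c i = 0} (Pow {..<N})"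
proof (rule bij_betw_byWitness[where f' = "\<lambda>A i. of_bool (i \<in> A)"])
  show "\<forall>c\<in>{c :: nat \<Rightarrow> bit. \<forall>i\<ge>N. c i = 0}. (\<lambda>i. of_bool (i \<in> {i. c i = 1})) = c"
    by (force simp: of_bool_def fun_eq_iff)
  show "(\<lambda>c. {i. c i = 1}) ` {c :: nat \<Rightarrow> bit. \<forall>i\<ge>N. c i = 0} \<subseteq> Pow {..<N}"
    by (force simp: not_le[symmetric])
qed auto

lemma card_words: "card {c :: nat \<Rightarrow> bit. \<forall>i\<ge>N. c i = 0} = 2 ^ N"
  using bij_betw_same_card[OF words_bij_Pow] by (simp add: card_Pow)

lemma finite_words: "finite {c :: nat \<Rightarrow> bit. \<forall>i\<ge>N. c i = 0}"
  using bij_betw_finite[OF words_bij_Pow] by simp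

lemma exit_ind_permute:
  assumes "code_automorphism C N \<pi>"
  shows "exit_ind C (\<pi> i) (\<pi> ` E) = exit_ind C i E"
proof -
  have p: "\<pi> permutes {..<N}" and C: "c \<circ> \<pi> \<in> C \<longleftrightarrow> c \<in> C" for c
    using assms by (auto simp: code_automorphism_def)
  have bij: "bij \<pi>" using p by (rule permutes_bij)
  have sh: "c \<circ> \<pi> \<in> shortened C A \<longleftrightarrow> c \<in> shortened C (\<pi> ` A)" for c A
  proof -
    have "(\<forall>j. j \<notin> A \<longrightarrow> c (\<pi> j) = 0) \<longleftrightarrow> (\<forall>j. \<pi> j \<notin> \<pi> ` A \<longrightarrow> c (\<pi> j) = 0)"
      using bij by (simp add: bij_is_inj inj_image_mem_iff)
    also have "\<dots> \<longleftrightarrow> (\<forall>k. k \<notin> \<pi> ` A \<longrightarrow> c k = 0)"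
      using bij by (metis bij_pointE)
    finally show ?thesis unfolding shortened_def using C by auto
  qed
  have "(\<exists>y \<in> shortened C (insert (\<pi> i) (\<pi> ` E)). y (\<pi> i) = 1)
     \<longleftrightarrow> (\<exists>y \<in> shortened C (insert i E). y i = 1)"
  proof
    assume "\<exists>y \<in> shortened C (insert (\<pi> i) (\<pi> ` E)). y (\<pi> i) = 1"
    then obtain y where "y \<in> shortened C (\<pi> ` insert i E)" "y (\<pi> i) = 1" by auto
    then show "\<exists>y \<in> shortened C (insert i E). y i = 1"
      using sh by (intro bexI[of _ "y \<circ> \<pi>"]) auto
  next
    assume "\<exists>y \<in> shortened C (insert i E). y i = 1"
    then obtain y where y: "y \<in> shortened C (insert i E)" "y i = 1" by auto
    have "y = (y \<circ> inv_into UNIV \<pi>) \<circ> \<pi>" using bij by (simp add: comp_assoc bij_is_inj)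
    then show "\<exists>y \<in> shortened C (insert (\<pi> i) (\<pi> ` E)). y (\<pi> i) = 1"
      using y sh[of "y \<circ> inv_into UNIV \<pi>" "insert i E"] bij
      by (intro bexI[of _ "y \<circ> inv_into UNIV \<pi>"]) (auto simp: bij_is_inj)
  qed
  then show ?thesis unfolding exit_ind_def by simp
qed

context binary_linear_code
begin

lemma finite_code: "finite C"
  by (rule finite_subset[OF _ finite_words[of N]]) (use length in auto)

lemma card_shortened_pos: "0 < card (shortened C E)"
  unfolding shortened_def using finite_code zero by (auto simp: card_gt_0_iff)

text \<open>Adding \<open>y\<close> exchanges the words that vanish at \<open>i\<close> with those
  that equal 1 there, so each kind makes up half of the larger code.\<close>

lemma card_shortened_insert:
  assumes "y \<in> shortened C (insert i E)" "y i = 1"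
  shows "card (shortened C (insert i E)) = 2 * card (shortened C (E - {i}))"
proof -
  let ?A = "shortened C (E - {i})" and ?B = "{c \<in> shortened C (insert i E). c i = 1}"
  let ?s = "\<lambda>c j. c j + y j"
  have closed: "?s c \<in> shortened C (insert i E)" if "c \<in> shortened C (insert i E)" for c
    using that assms(1) add unfolding shortened_def by auto
  have invol: "?s (?s c) = c" for c
    by (simp only: bit_add_cancel_right)
  have A: "?A = {c \<in> shortened C (insert i E). c i = 0}"
    unfolding shortened_def by auto
  have "bij_betw ?s ?A ?B"
    by (rule bij_betw_byWitness[where f' = ?s])
      (use invol closed assms(2) in \<open>auto simp: A\<close>)
  then have eq: "card ?A = card ?B" by (rule bij_betw_same_card)
  have un: "shortened C (insert i E) = ?A \<union> ?B" and disj: "?A \<inter> ?B = {}"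
    unfolding A by auto
  have "finite ?A" "finite ?B"
    using finite_code unfolding shortened_def by auto
  then have "card (?A \<union> ?B) = card ?A + card ?B" using disj by (rule card_Un_disjoint)
  then show ?thesis unfolding un[symmetric] eq[symmetric] by simp
qed

text \<open>The dimension of the shortened code jumps by one at \<open>i\<close> exactly in the
  extrinsic event. With Russo's formula this makes the extrinsic probabilities the derivative of an
  expected dimension.\<close>

lemma flip_diff_log_card_shortened:
  "flip_diff i (\<lambda>E. log 2 (card (shortened C E))) = exit_ind C i"
proof
  fix E
  show "flip_diff i (\<lambda>E. log 2 (card (shortened C E))) E = exit_ind C i E"
  proof (cases "\<exists>y \<in> shortened C (insert i E). y i = 1")
    case True
    then have "card (shortened C (insert i E)) = 2 * card (shortened C (E - {i}))"
      using card_shortened_insert by blast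
    then show ?thesis
      using True card_shortened_pos[of "E - {i}"]
      by (simp add: flip_diff_def exit_ind_def log_mult)
  next
    case False
    then have "shortened C (insert i E) = shortened C (E - {i})"
      unfolding shortened_def by auto
    then show ?thesis using False by (simp add: flip_diff_def exit_ind_def)
  qed
qed

lemma exit_ind_mono: "E \<subseteq> E' \<Longrightarrow> exit_ind C i E \<le> exit_ind C i E'"
  unfolding exit_ind_def shortened_def by (auto simp: of_bool_def)

text \<open>For a monotone indicator each difference equals its own square and absolute value, so
  energy, influences and slope are all built from the same averages.\<close>

lemma flip_diff_exit_ind: "flip_diff j (exit_ind C i) E \<in> {0, 1}"
proof -
  have "exit_ind C i (E - {j}) \<le> exit_ind C i (insert j E)"
    by (rule exit_ind_mono) auto
  moreover have "exit_ind C i A \<in> {0, 1}" for A by (auto simp: exit_ind_def)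
  ultimately show ?thesis
    unfolding flip_diff_def by (smt (verit) insert_iff singletonD)
qed

lemma flip_diff_exit_ind_same: "flip_diff i (exit_ind C i) = (\<lambda>E. 0)"
  by (simp add: flip_diff_def exit_ind_def fun_eq_iff)

text \<open>The sum of two codewords compatible with the same received word is a codeword supported
  on the erasures, and it equals 1 where the two disagree.\<close>

lemma bit_undetermined_imp_exit:
  assumes "x \<in> C" "i < N" "bit_undetermined C N E x i"
  shows "exit_ind C i E = 1"
proof -
  obtain y where y: "y \<in> C" "\<And>j. j < N \<Longrightarrow> j \<notin> E \<Longrightarrow> y j = x j" "y i \<noteq> x i"
    using assms(3) unfolding bit_undetermined_def by auto
  let ?z = "\<lambda>j. x j + y j"
  have "?z j = 0" if "j \<notin> E" for j
    using y(2)[of j] that length[OF assms(1)] length[OF y(1)] bit_add_eq_0_iff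
    by (cases "j < N") auto
  then have "?z \<in> shortened C (insert i E)"
    unfolding shortened_def using add[OF assms(1) y(1)] by auto
  moreover have "?z i = 1" using y(3) bit_add_eq_0_iff[of "x i" "y i"] by force
  ultimately have "\<exists>y \<in> shortened C (insert i E). y i = 1"
    by (rule bexI[of "\<lambda>y. y i = 1" ?z, rotated])
  then show ?thesis by (simp only: exit_ind_def of_bool_eq)
qed

end

section \<open>The EXIT function of a doubly transitive code\<close>

lemma bit_MAP_error_nonneg: "0 \<le> p \<Longrightarrow> p \<le> 1 \<Longrightarrow> 0 \<le> bit_MAP_error C N p"
  unfolding bit_MAP_error_def erasure_prob_def
  by (intro mult_nonneg_nonneg sum_nonneg) auto

text \<open>Double transitivity is stated through a base point: transitivity makes the EXIT
  functions of all bits equal, and transitivity of the stabilizer of \<open>i0\<close> makes all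
  influences on bit \<open>i0\<close> equal.\<close>

locale two_transitive_code = binary_linear_code +
  fixes i0 :: nat
  assumes base: "i0 < N"
    and transitive: "i < N \<Longrightarrow> \<exists>\<pi>. code_automorphism C N \<pi> \<and> \<pi> i0 = i"
    and stabilizer_transitive: "j < N \<Longrightarrow> k < N \<Longrightarrow> j \<noteq> i0 \<Longrightarrow> k \<noteq> i0
      \<Longrightarrow> \<exists>\<pi>. code_automorphism C N \<pi> \<and> \<pi> i0 = i0 \<and> \<pi> j = k"
begin

definition exit_fun :: "real \<Rightarrow> real" where
  "exit_fun t = cube_avg t N (exit_ind C i0)"

definition exit_slope :: "real \<Rightarrow> real" where
  "exit_slope t = (\<Sum>j<N. cube_avg t N (flip_diff j (exit_ind C i0)))"

lemma exit_avg_eq: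
  assumes "i < N" shows "cube_avg t N (exit_ind C i) = exit_fun t"
proof -
  obtain \<pi> where \<pi>: "code_automorphism C N \<pi>" "\<pi> i0 = i"
    using transitive[OF assms] by auto
  then have "\<pi> permutes {..<N}" by (simp add: code_automorphism_def)
  from cube_avg_permute[OF this, of t "exit_ind C i"] show ?thesis
    unfolding exit_fun_def using exit_ind_permute[OF \<pi>(1), of i0] \<pi>(2) by simp
qed

lemma influence_eq:
  assumes "j < N" "k < N" "j \<noteq> i0" "k \<noteq> i0"
  shows "cube_avg t N (flip_diff j (exit_ind C i0)) = cube_avg t N (flip_diff k (exit_ind C i0))"
proof -
  obtain \<pi> where \<pi>: "code_automorphism C N \<pi>" "\<pi> i0 = i0" "\<pi> j = k"
    using stabilizer_transitive[OF assms] by auto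
  then have p: "\<pi> permutes {..<N}" by (simp add: code_automorphism_def)
  have "flip_diff k (exit_ind C i0) (\<pi> ` E) = flip_diff j (exit_ind C i0) E" for E
  proof -
    have "insert k (\<pi> ` E) = \<pi> ` insert j E" "\<pi> ` E - {k} = \<pi> ` (E - {j})"
      using \<pi>(3) permutes_inj[OF p] by (auto dest: injD)
    then show ?thesis
      unfolding flip_diff_def using exit_ind_permute[OF \<pi>(1), of i0] \<pi>(2) by metis
  qed
  then show ?thesis
    using cube_avg_permute[OF p, of t "flip_diff k (exit_ind C i0)"] by simp
qed

lemma exit_fun_has_derivative: "(exit_fun has_real_derivative exit_slope t) (at t)"
  unfolding exit_fun_def[abs_def] exit_slope_def by (rule cube_avg_has_derivative)

lemma exit_slope_nonneg:
  assumes "0 \<le> t" "t \<le> 1" shows "0 \<le> exit_slope t"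
  unfolding exit_slope_def
proof (intro sum_nonneg cube_avg_nonneg assms)
  show "0 \<le> flip_diff j (exit_ind C i0) E" for j E
    using flip_diff_exit_ind[of j i0 E] by auto
qed

lemma exit_fun_mono:
  assumes "0 \<le> a" "a \<le> b" "b \<le> 1"
  shows "exit_fun a \<le> exit_fun b"
proof (rule DERIV_nonneg_imp_nondecreasing[OF assms(2)])
  fix x assume "a \<le> x" "x \<le> b"
  then show "\<exists>y. (exit_fun has_real_derivative y) (at x) \<and> 0 \<le> y"
    using exit_fun_has_derivative[of x] exit_slope_nonneg[of x] assms by auto
qed

lemma exit_fun_bounds:
  assumes "0 \<le> t" "t \<le> 1" shows "0 \<le> exit_fun t" "exit_fun t \<le> 1"
proof -
  show "0 \<le> exit_fun t" unfolding exit_fun_def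
    by (rule cube_avg_nonneg[OF assms]) (auto simp: exit_ind_def)
  show "exit_fun t \<le> 1" unfolding exit_fun_def
    using cube_avg_mono[OF assms, of N "exit_ind C i0" "\<lambda>_. 1"]
    by (auto simp: exit_ind_def cube_avg_const)
qed

text \<open>With N - 1 equal influences and a zero at \<open>i0\<close>, the sum of squared
  influences is the squared slope divided by N - 1. For large \<open>s\<close>, and then larger
  \<open>N\<close>, a bounded slope therefore forces the variance h (1 - h) to be small.\<close>

lemma exit_slope_lower_bound:
  assumes t: "0 < t" "t < 1" and N: "N \<ge> 2"
  shows "s * (exit_fun t * (1 - exit_fun t))
    \<le> 2 / min t (1 - t) * exit_slope t + exp s * ((exit_slope t)\<^sup>2 / (real N - 1))"
proof -
  let ?f = "exit_ind C i0"
  obtain k where k: "k < N" "k \<noteq> i0"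
    using N by (cases "i0 = 0") (force intro: that[of 1], force intro: that[of 0])
  define J where "J = cube_avg t N (flip_diff k ?f)"
  have flip: "\<bar>flip_diff j ?f E\<bar> = flip_diff j ?f E" "(flip_diff j ?f E)\<^sup>2 = flip_diff j ?f E" for j E
    using flip_diff_exit_ind[of j i0 E] by auto
  have J: "cube_avg t N (flip_diff j ?f) = (if j = i0 then 0 else J)" if "j < N" for j
    using influence_eq[OF that k(1) _ k(2)] flip_diff_exit_ind_same
    by (auto simp: J_def cube_avg_const flip_diff_exit_ind_same)
  have sumJ: "(\<Sum>j<N. if j = i0 then 0 else x) = (real N - 1) * x" for x :: real
  proof -
    have "(\<Sum>j<N. if j = i0 then 0 else x) = (\<Sum>j\<in>{..<N} - {i0}. x)"
      by (rule sum.mono_neutral_cong_right) auto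
    then show ?thesis using base by (simp add: of_nat_diff)
  qed
  have slope: "exit_slope t = (real N - 1) * J"
    unfolding exit_slope_def using J sumJ[of J] by simp
  have "(\<Sum>j<N. (cube_avg t N (\<lambda>E. \<bar>flip_diff j ?f E\<bar>))\<^sup>2) = (\<Sum>j<N. if j = i0 then 0 else J\<^sup>2)"
    by (rule sum.cong) (auto simp: flip J)
  also have "\<dots> = (exit_slope t)\<^sup>2 / (real N - 1)"
    unfolding sumJ slope using N by (simp add: power2_eq_square)
  finally have sq: "(\<Sum>j<N. (cube_avg t N (\<lambda>E. \<bar>flip_diff j ?f E\<bar>))\<^sup>2)
    = (exit_slope t)\<^sup>2 / (real N - 1)" .
  have en: "energy t N ?f = t * (1 - t) * exit_slope t"
    unfolding energy_def exit_slope_def flip ..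
  have "t * (1 - t) \<le> 1" using t mult_mono[of t 1 "1 - t" 1] by auto
  then have "t * (1 - t) * exit_slope t \<le> exit_slope t"
    using exit_slope_nonneg[of t] t by (simp add: mult_left_le_one_le)
  then have en': "2 / min t (1 - t) * energy t N ?f \<le> 2 / min t (1 - t) * exit_slope t"
    unfolding en using t by (intro mult_left_mono) auto
  have "(\<lambda>E. (?f E)\<^sup>2) = ?f" by (auto simp: exit_ind_def fun_eq_iff)
  then have "cube_var t N ?f = exit_fun t * (1 - exit_fun t)"
    unfolding cube_var_def exit_fun_def by (simp add: algebra_simps power2_eq_square)
  with falik_samorodnitsky[OF t, of s N ?f] en' show ?thesis
    unfolding sq by simp
qed

text \<open>The expected dimension of the subcode supported on the erasures has derivative
  \<open>N * exit_fun\<close> and climbs from \<open>0\<close> to \<open>dim C\<close>: one half of the area theorem.\<close>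
lemma exit_fun_le_rate:
  assumes "0 \<le> q" "q < 1"
  shows "exit_fun q * (1 - q) \<le> code_rate C N"
proof -
  let ?d = "\<lambda>E. log 2 (card (shortened C E))"
  define G where "G t = cube_avg t N ?d" for t
  have deriv: "(G has_real_derivative real N * exit_fun t) (at t)" for t
    using cube_avg_has_derivative[of N ?d t] exit_avg_eq[of _ t]
    by (simp add: G_def[abs_def] flip_diff_log_card_shortened)
  \<comment> \<open>The mean value theorem stands in for integrating the EXIT function over [q, 1];
    monotonicity then replaces \<open>z\<close> by \<open>q\<close>.\<close>
  obtain z where z: "q < z" "z < 1" "G 1 - G q = (1 - q) * (real N * exit_fun z)"
    using MVT2[OF assms(2), of G "\<lambda>t. real N * exit_fun t"] deriv by auto
  have "0 \<le> ?d E" for E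
    using card_shortened_pos[of E] by (simp add: Suc_leI)
  then have "0 \<le> G q" unfolding G_def using assms by (intro cube_avg_nonneg) auto
  moreover have "G 1 = log 2 (card C)"
  proof -
    have "cube_avg 1 M g = g {..<M}" for M and g :: "nat set \<Rightarrow> real"
      by (induction M arbitrary: g) (auto simp: lessThan_Suc)
    moreover have "shortened C {..<N} = C" using length by (auto simp: shortened_def)
    ultimately show ?thesis by (simp add: G_def)
  qed
  ultimately have "(1 - q) * (real N * exit_fun z) \<le> log 2 (card C)" using z by simp
  moreover have "(1 - q) * (real N * exit_fun q) \<le> (1 - q) * (real N * exit_fun z)"
    using exit_fun_mono[of q z] z assms by (intro mult_left_mono) auto
  ultimately have "(exit_fun q * (1 - q)) * real N \<le> log 2 (card C)" by (simp add: mult_ac)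
  then show ?thesis using base unfolding code_rate_def by (simp add: field_simps)
qed

lemma bit_MAP_error_le_exit_fun:
  assumes "0 \<le> p" "p \<le> 1"
  shows "bit_MAP_error C N p \<le> exit_fun p"
proof -
  have "(\<Sum>E\<in>Pow {..<N}. erasure_prob p N E *
         ((1 / real (card C)) * real (card {x\<in>C. bit_undetermined C N E x i}))) \<le> exit_fun p"
    if "i < N" for i
  proof -
    \<comment> \<open>The extrinsic event depends on \<open>E\<close> alone, so its indicator bounds
      the fraction of transmitted words for which bit \<open>i\<close> is lost.\<close>
    have "(1 / real (card C)) * real (card {x\<in>C. bit_undetermined C N E x i}) \<le> exit_ind C i E" for E
    proof (cases "exit_ind C i E = 1")
      case True
      have "card {x\<in>C. bit_undetermined C N E x i} \<le> card C"
        using finite_code by (intro card_mono) auto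
      then show ?thesis using True by (cases "card C = 0") (auto simp: divide_le_eq_1)
    next
      case False
      then have "{x\<in>C. bit_undetermined C N E x i} = {}"
        using bit_undetermined_imp_exit that by blast
      then have "card {x\<in>C. bit_undetermined C N E x i} = 0" by (simp only: card.empty)
      then show ?thesis by (simp add: exit_ind_def)
    qed
    then have "(\<Sum>E\<in>Pow {..<N}. erasure_prob p N E *
         ((1 / real (card C)) * real (card {x\<in>C. bit_undetermined C N E x i})))
       \<le> (\<Sum>E\<in>Pow {..<N}. erasure_prob p N E * exit_ind C i E)"
      using assms by (intro sum_mono mult_left_mono) (auto simp: erasure_prob_def)
    also have "\<dots> = exit_fun p"
      unfolding exit_avg_eq[OF that, symmetric] cube_avg_eq_sum erasure_prob_def ..
    finally show ?thesis .
  qed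
  then have "(\<Sum>i<N. \<Sum>E\<in>Pow {..<N}. erasure_prob p N E *
         ((1 / real (card C)) * real (card {x\<in>C. bit_undetermined C N E x i})))
      \<le> (\<Sum>i<N. exit_fun p)" by (intro sum_mono) auto
  then show ?thesis unfolding bit_MAP_error_def using base by (simp add: field_simps)
qed

text \<open>If the EXIT function has not dropped below \<open>\<epsilon>\<close> at \<open>a\<close>, then it has slope at most
  \<open>1 / (b - a)\<close> somewhere in between \<open>a\<close> and \<open>b\<close>, where its variance is still bounded below.\<close>
lemma exit_fun_small:
  assumes ab: "0 < a" "a < b" "b < 1"
    and rate: "code_rate C N \<le> \<rho>" "\<rho> < 1 - b" and \<epsilon>: "0 < \<epsilon>"
  defines "\<eta> \<equiv> 1 - \<rho> / (1 - b)" and "K \<equiv> 1 / (b - a)" and "c \<equiv> 2 / min a (1 - b)"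
  assumes N: "N \<ge> 2" "exp ((c * K + 2) / (\<epsilon> * \<eta>)) * K\<^sup>2 \<le> real N - 1"
  shows "exit_fun a < \<epsilon>"
proof (rule ccontr)
  assume "\<not> ?thesis"
  then have ea: "\<epsilon> \<le> exit_fun a" by simp
  \<comment> \<open>With this \<open>s\<close> the variance term is at least
    \<open>c * K + 2\<close>, while the right side of the slope inequality will be at most
    \<open>c * K + 1\<close>, the last 1 coming from the size of \<open>N\<close>.\<close>
  define s where "s = (c * K + 2) / (\<epsilon> * \<eta>)"
  obtain z where z: "a < z" "z < b" "exit_fun b - exit_fun a = (b - a) * exit_slope z"
    using MVT2[OF ab(2), of exit_fun exit_slope] exit_fun_has_derivative by auto
  have \<eta>: "\<eta> > 0" unfolding \<eta>_def using rate ab by simp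
  have K: "K > 0" unfolding K_def using ab by simp
  have c: "c > 0" unfolding c_def using ab by simp
  have s: "s > 0" unfolding s_def using c K \<epsilon> \<eta> by (intro divide_pos_pos) (auto simp: add_pos_pos)
  have hz: "\<epsilon> \<le> exit_fun z" using ea exit_fun_mono[of a z] z ab by linarith
  have "exit_fun b * (1 - b) \<le> \<rho>" using exit_fun_le_rate[of b] rate ab by linarith
  then have "exit_fun b \<le> \<rho> / (1 - b)" using ab by (simp add: field_simps)
  \<comment> \<open>The rate bound at \<open>b\<close> keeps the EXIT function away from 1 on all of
    [a, b], with margin \<eta>.\<close>
  then have hz': "\<eta> \<le> 1 - exit_fun z"
    using exit_fun_mono[of z b] z ab unfolding \<eta>_def by linarith
  have slope0: "0 \<le> exit_slope z" using exit_slope_nonneg z ab by simp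
  have "(b - a) * exit_slope z \<le> 1"
    using z(3) exit_fun_bounds[of a] exit_fun_bounds[of b] ab by linarith
  then have slope: "exit_slope z \<le> K" unfolding K_def using ab by (simp add: field_simps)
  have "c * K + 2 = s * (\<epsilon> * \<eta>)" unfolding s_def using \<epsilon> \<eta> by simp
  also have "\<dots> \<le> s * (exit_fun z * (1 - exit_fun z))"
    using s hz hz' \<epsilon> \<eta> by (intro mult_left_mono mult_mono) auto
  also have "\<dots> \<le> 2 / min z (1 - z) * exit_slope z + exp s * ((exit_slope z)\<^sup>2 / (real N - 1))"
    using exit_slope_lower_bound[of z s] z ab N by simp
  also have "\<dots> \<le> c * K + exp s * (K\<^sup>2 / (real N - 1))"
  proof (intro add_mono mult_mono mult_left_mono divide_right_mono power_mono slope slope0)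
    show "2 / min z (1 - z) \<le> c" unfolding c_def using z ab by (intro divide_left_mono) auto
  qed (use c N in auto)
  also have "exp s * (K\<^sup>2 / (real N - 1)) \<le> 1"
    using N unfolding s_def by simp
  finally show False by simp
qed

end

section \<open>Vanishing bit error for doubly transitive codes of growing length\<close>

theorem two_transitive_codes_bit_MAP_error_tendsto_0:
  assumes codes: "\<forall>\<^sub>F m in sequentially. two_transitive_code (C m) (N m) (i0 m)"
    and N: "filterlim N at_top sequentially"
    and rate: "(\<lambda>m. code_rate (C m) (N m)) \<longlonglongrightarrow> r" and r: "0 < r"
    and p: "0 \<le> p" "p < 1 - r"
  shows "(\<lambda>m. bit_MAP_error (C m) (N m) p) \<longlonglongrightarrow> 0"
proof (rule LIMSEQ_I)
  fix \<epsilon> :: real assume \<epsilon>: "0 < \<epsilon>"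
  \<comment> \<open>Midpoints give p < a < b < 1 - r and then r < \<rho> < 1 - b: room for the slope
    argument, and slack for rates that only converge to \<open>r\<close>.\<close>
  define a where "a = (p + (1 - r)) / 2"
  define b where "b = (a + (1 - r)) / 2"
  define \<rho> where "\<rho> = (r + (1 - b)) / 2"
  have ab: "0 < a" "p < a" "a < b" "b < 1" "b < 1 - r" using p r unfolding a_def b_def by (auto simp: field_simps)
  have \<rho>: "r < \<rho>" "\<rho> < 1 - b" using ab unfolding \<rho>_def by auto
  \<comment> \<open>The length threshold of \<open>exit_fun_small\<close>; it is independent of
    \<open>m\<close>, hence eventually exceeded.\<close>
  define Y where "Y = exp ((2 / min a (1 - b) * (1 / (b - a)) + 2) / (\<epsilon> * (1 - \<rho> / (1 - b)))) * (1 / (b - a))\<^sup>2"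
  have "\<forall>\<^sub>F m in sequentially. N m \<ge> max 2 (nat \<lceil>Y + 1\<rceil>)"
    using N unfolding filterlim_at_top by blast
  moreover have "\<forall>\<^sub>F m in sequentially. code_rate (C m) (N m) < \<rho>"
    using order_tendstoD(2)[OF rate \<rho>(1)] .
  ultimately have "\<forall>\<^sub>F m in sequentially. norm (bit_MAP_error (C m) (N m) p - 0) < \<epsilon>"
    using codes
  proof eventually_elim
    case (elim m)
    then interpret two_transitive_code "C m" "N m" "i0 m" by simp
    have "real (N m) - 1 \<ge> Y" "N m \<ge> 2" using elim(1) by linarith+
    then have "exit_fun a < \<epsilon>"
      using ab \<rho> \<epsilon> elim(2) by (intro exit_fun_small[of a b \<rho>]) (auto simp: Y_def)
    moreover have "bit_MAP_error (C m) (N m) p \<le> exit_fun p"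
      using ab p by (intro bit_MAP_error_le_exit_fun) auto
    moreover have "exit_fun p \<le> exit_fun a" using ab p by (intro exit_fun_mono) auto
    moreover have "0 \<le> bit_MAP_error (C m) (N m) p" using ab p by (intro bit_MAP_error_nonneg) auto
    ultimately show ?case by simp
  qed
  then show "\<exists>n0. \<forall>m\<ge>n0. norm (bit_MAP_error (C m) (N m) p - 0) < \<epsilon>"
    by (simp add: eventually_sequentially)
qed

section \<open>Extended BCH codes\<close>

text \<open>Scalar multiplication of F_2 on the field, which avoids an embedding of type
  \<open>bit\<close> into the carrier.\<close>

definition bit_scale :: "('a, 'b) ring_scheme \<Rightarrow> bit \<Rightarrow> 'a \<Rightarrow> 'a" where
  "bit_scale R b x = (if b = 0 then \<zero>\<^bsub>R\<^esub> else x)"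

locale BCH_field = field R for R :: "('a, 'b) ring_scheme" (structure) +
  fixes m :: nat and \<alpha> :: 'a
  assumes m_pos: "1 \<le> m"
    and finite_carrier: "finite (carrier R)"
    and card_carrier: "card (carrier R) = 2 ^ m"
    and primitive: "primitive_elem R \<alpha>"
begin

definition n :: nat where "n = 2 ^ m - 1"

lemma n_bounds: "1 \<le> n" "Suc n = 2 ^ m" "odd n"
proof -
  show "Suc n = 2 ^ m" by (simp add: n_def)
  obtain k where "m = Suc k" using m_pos by (cases m) auto
  then have "(2::nat) ^ m = 2 * 2 ^ k" "(1::nat) \<le> 2 ^ k" by simp_all
  then have "n = Suc (2 * (2 ^ k - 1))" unfolding n_def by presburger
  then show "1 \<le> n" "odd n" by simp_all
qed

lemma lessThan_eq: "{..<2 ^ m} = insert n {..<n}"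
  using n_bounds(2) by (metis lessThan_Suc)

lemma alpha_closed: "\<alpha> \<in> carrier R" and
  powers_alpha: "{\<alpha> [^] (k::nat) | k. True} = carrier R - {\<zero>}"
  using primitive by (auto simp: primitive_elem_def)

lemma pow_n:
  assumes "x \<in> carrier R" "x \<noteq> \<zero>" shows "x [^] n = \<one>"
proof -
  have "card (Units R) = n"
    unfolding field_Units using finite_carrier card_carrier by (simp add: card_Diff_singleton n_def)
  then show ?thesis
    using units_power_order_eq_one[of x] assms finite_carrier by (simp add: field_Units)
qed

text \<open>Characteristic 2 is read off from the order: \<open>n\<close> is odd, so the
  \<open>n\<close>-th power of minus one is minus one, yet it is also 1 because the unit group has
  order \<open>n\<close>.\<close>

lemma add_self:
  assumes "x \<in> carrier R" shows "x \<oplus> x = \<zero>"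
proof -
  obtain k where k: "n = Suc (2 * k)" using n_bounds(3) by (auto elim!: oddE)
  have "(\<ominus> \<one>) [^] n = (\<ominus> \<one> [^] (2::nat)) [^] k \<otimes> (\<ominus> \<one>)"
    unfolding k by (simp add: nat_pow_pow)
  also have "\<ominus> \<one> [^] (2::nat) = \<one>" by (simp add: numeral_2_eq_2 l_minus r_minus)
  finally have "(\<ominus> \<one>) [^] n = \<ominus> \<one>" by simp
  moreover have "(\<ominus> \<one>) [^] n = \<one>"
    by (rule pow_n) (use one_not_zero in \<open>auto simp: add.inv_eq_1_iff\<close>)
  ultimately have "\<ominus> \<one> = \<one>" by simp
  then have "\<ominus> x = x" using assms l_minus[of \<one> x] by simp
  then show ?thesis using r_neg[OF assms] by simp
qed

lemma scale_closed [simp]: "x \<in> carrier R \<Longrightarrow> bit_scale R b x \<in> carrier R"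
  by (simp add: bit_scale_def)

lemma scale_zero [simp]: "bit_scale R 0 x = \<zero>" "bit_scale R b \<zero> = \<zero>"
  and scale_one [simp]: "bit_scale R 1 x = x"
  by (simp_all add: bit_scale_def)

lemma scale_add_left:
  "x \<in> carrier R \<Longrightarrow> bit_scale R (b + c) x = bit_scale R b x \<oplus> bit_scale R c x"
  using add_self[of x] by (cases "b = 0"; cases "c = 0") (auto simp: bit_scale_def)

lemma scale_add_right:
  "x \<in> carrier R \<Longrightarrow> y \<in> carrier R \<Longrightarrow> bit_scale R b (x \<oplus> y) = bit_scale R b x \<oplus> bit_scale R b y"
  by (simp add: bit_scale_def)

lemma scale_mult_right:
  "a \<in> carrier R \<Longrightarrow> bit_scale R b (a \<otimes> x) = a \<otimes> bit_scale R b x"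
  by (simp add: bit_scale_def)

lemma scale_sum:
  "x \<in> carrier R \<Longrightarrow> bit_scale R (\<Sum>j<k. c j) x = (\<Oplus>j\<in>{..<k}. bit_scale R (c j) x)" for k :: nat
proof (induction k)
  case (Suc k)
  then show ?case
    unfolding lessThan_Suc
    by (subst finsum_insert) (auto simp: scale_add_left a_comm simp del: add_bit_eq_xor)
qed simp

section \<open>Evaluating binary polynomials at field elements\<close>

lemma eval_F2_eq:
  assumes "degree g < k" "x \<in> carrier R"
  shows "eval_F2 R g x = (\<Oplus>i\<in>{..<k}. bit_scale R (coeff g i) (x [^] i))"
  unfolding eval_F2_def bit_scale_def
  by (rule add.finprod_mono_neutral_cong_left)
    (use assms in \<open>auto simp: coeff_eq_0 not_le\<close>)

lemma eval_F2_closed [simp]: "x \<in> carrier R \<Longrightarrow> eval_F2 R g x \<in> carrier R"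
  using eval_F2_eq[of g "Suc (degree g)" x] by simp

lemma eval_F2_zero [simp]: "x \<in> carrier R \<Longrightarrow> eval_F2 R 0 x = \<zero>"
  using eval_F2_eq[of 0 1 x] by simp

lemma eval_F2_add:
  assumes "x \<in> carrier R"
  shows "eval_F2 R (g + h) x = eval_F2 R g x \<oplus> eval_F2 R h x"
proof -
  define k where "k = Suc (max (degree g) (degree h))"
  have "degree g < k" "degree h < k" "degree (g + h) < k"
    unfolding k_def using degree_add_le_max[of g h] by auto
  then show ?thesis
    using assms
    by (simp add: eval_F2_eq scale_add_left del: add_bit_eq_xor)
qed

lemma eval_F2_pCons:
  assumes "x \<in> carrier R"
  shows "eval_F2 R (pCons a g) x = bit_scale R a \<one> \<oplus> x \<otimes> eval_F2 R g x"
proof -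
  have *: "(\<Oplus>i\<in>{..<Suc k}. bit_scale R (coeff (pCons a g) i) (x [^] i))
     = bit_scale R a \<one> \<oplus> x \<otimes> (\<Oplus>i\<in>{..<k}. bit_scale R (coeff g i) (x [^] i))" for k
  proof (induction k)
    case 0
    then show ?case using assms by (simp add: lessThan_Suc)
  next
    case (Suc k)
    have "(\<Oplus>i\<in>{..<Suc (Suc k)}. bit_scale R (coeff (pCons a g) i) (x [^] i))
       = bit_scale R (coeff g k) (x [^] Suc k) \<oplus>
         (\<Oplus>i\<in>{..<Suc k}. bit_scale R (coeff (pCons a g) i) (x [^] i))"
      unfolding lessThan_Suc[of "Suc k"] by (subst finsum_insert) (use assms in auto)
    moreover have "(\<Oplus>i\<in>{..<Suc k}. bit_scale R (coeff g i) (x [^] i))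
       = bit_scale R (coeff g k) (x [^] k) \<oplus> (\<Oplus>i\<in>{..<k}. bit_scale R (coeff g i) (x [^] i))"
      unfolding lessThan_Suc[of k] by (subst finsum_insert) (use assms in auto)
    moreover have "bit_scale R (coeff g k) (x [^] Suc k) = x \<otimes> bit_scale R (coeff g k) (x [^] k)"
      using assms scale_mult_right[of x "coeff g k" "x [^] k"] by (simp add: m_comm)
    ultimately show ?case
      using Suc.IH assms by (simp add: r_distr a_lcomm)
  qed
  have "degree (pCons a g) < Suc (Suc (degree g))"
    using degree_pCons_le[of a g] by simp
  then show ?thesis
    using *[of "Suc (degree g)"] assms by (simp add: eval_F2_eq[of g "Suc (degree g)"] eval_F2_eq)
qed

lemma eval_F2_mult_eq_zero:
  assumes "x \<in> carrier R" "eval_F2 R g x = \<zero>"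
  shows "eval_F2 R (g * h) x = \<zero>"
proof (induction h)
  case (pCons a h)
  \<comment> \<open>Over F_2 a scalar multiple of \<open>g\<close> is \<open>g\<close> or 0, so both
    summands of the product with \<open>pCons a h\<close> vanish at \<open>x\<close>.\<close>
  have "smult a g = g \<or> smult a g = 0" by (cases "a = 0") auto
  then show ?case
    using pCons.IH assms
    by (auto simp: eval_F2_add eval_F2_pCons)
qed (use assms in simp)

lemma eval_F2_monom: "x \<in> carrier R \<Longrightarrow> eval_F2 R (monom 1 k) x = x [^] k"
  by (induction k) (simp_all add: monom_0 monom_Suc eval_F2_pCons m_comm)

section \<open>The generator polynomial, and extended BCH codes through moments\<close>

lemma BCH_gen_minimal:
  "BCH_gen R \<alpha> v \<noteq> 0 \<and> has_BCH_roots R \<alpha> v (BCH_gen R \<alpha> v) \<and>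
     (\<forall>h. h \<noteq> 0 \<and> has_BCH_roots R \<alpha> v h \<longrightarrow> degree (BCH_gen R \<alpha> v) \<le> degree h)"
proof -
  let ?P = "\<lambda>g. g \<noteq> 0 \<and> has_BCH_roots R \<alpha> v g"
  \<comment> \<open>The polynomial X^n + 1 vanishes at every nonzero field element, so candidates
    exist and one of them has least degree.\<close>
  have "?P (monom 1 n + 1)"
  proof
    have "coeff (monom 1 n + 1) n \<noteq> (0::bit)" using n_bounds(1) by (simp add: coeff_eq_0)
    then show "monom 1 n + 1 \<noteq> (0 :: bit poly)" by (metis coeff_0)
    have "eval_F2 R (monom 1 n + 1) (\<alpha> [^] j) = \<zero>" for j :: nat
    proof -
      have "\<alpha> [^] j \<in> carrier R - {\<zero>}" using powers_alpha by auto
      then have "eval_F2 R (monom 1 n) (\<alpha> [^] j) = \<one>" using pow_n by (simp add: eval_F2_monom)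
      moreover have "eval_F2 R 1 (\<alpha> [^] j) = \<one>"
        using eval_F2_monom[of "\<alpha> [^] j" 0] alpha_closed by (simp add: monom_0 one_pCons)
      ultimately show ?thesis using alpha_closed add_self[of \<one>] by (simp add: eval_F2_add)
    qed
    then show "has_BCH_roots R \<alpha> v (monom 1 n + 1)" by (simp add: has_BCH_roots_def)
  qed
  from ex_has_least_nat[of ?P, OF this, of degree]
  have "\<exists>g. g \<noteq> 0 \<and> has_BCH_roots R \<alpha> v g \<and>
      (\<forall>h. h \<noteq> 0 \<and> has_BCH_roots R \<alpha> v h \<longrightarrow> degree g \<le> degree h)" by blast
  then show ?thesis unfolding BCH_gen_def by (rule someI_ex)
qed

text \<open>The remainder of \<open>c\<close> modulo the generator keeps the prescribed roots but
  has smaller degree if nonzero; minimality forces it to be 0.\<close>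

lemma BCH_gen_dvd_iff: "BCH_gen R \<alpha> v dvd c \<longleftrightarrow> has_BCH_roots R \<alpha> v c"
proof
  let ?g = "BCH_gen R \<alpha> v"
  assume "?g dvd c"
  then show "has_BCH_roots R \<alpha> v c"
    using BCH_gen_minimal[of v] eval_F2_mult_eq_zero alpha_closed
    by (auto simp: has_BCH_roots_def elim!: dvdE)
next
  let ?g = "BCH_gen R \<alpha> v"
  assume c: "has_BCH_roots R \<alpha> v c"
  have "has_BCH_roots R \<alpha> v (c mod ?g)"
    unfolding has_BCH_roots_def
  proof
    fix j assume j: "j \<in> {1..v}"
    have "eval_F2 R (?g * (c div ?g) + c mod ?g) (\<alpha> [^] j) = \<zero>"
      using c j unfolding mult_div_mod_eq by (simp add: has_BCH_roots_def)
    moreover have "eval_F2 R (?g * (c div ?g)) (\<alpha> [^] j) = \<zero>"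
      using BCH_gen_minimal[of v] j alpha_closed
      by (intro eval_F2_mult_eq_zero) (auto simp: has_BCH_roots_def)
    ultimately show "eval_F2 R (c mod ?g) (\<alpha> [^] j) = \<zero>"
      using alpha_closed unfolding eval_F2_add[OF nat_pow_closed[OF alpha_closed]] by simp
  qed
  then have "c mod ?g = 0"
    using BCH_gen_minimal[of v] degree_mod_less[of ?g c] by force
  then show "?g dvd c" by (simp add: mod_eq_0_iff_dvd)
qed

text \<open>Coordinate \<open>i < n\<close> is labelled by \<open>\<alpha>^i\<close> and the parity coordinate \<open>n\<close> by \<open>0\<close>; with
  \<open>0^0 = 1\<close> the parity check becomes the vanishing of the zeroth moment.\<close>
definition point :: "nat \<Rightarrow> 'a" where
  "point i = (if i < n then \<alpha> [^] i else \<zero>)"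

definition moment :: "(nat \<Rightarrow> bit) \<Rightarrow> nat \<Rightarrow> 'a" where
  "moment c j = (\<Oplus>i\<in>{..<2 ^ m}. bit_scale R (c i) (point i [^] j))"

definition moment_code :: "nat \<Rightarrow> (nat \<Rightarrow> bit) set" where
  "moment_code v = {c. (\<forall>i\<ge>2 ^ m. c i = 0) \<and> (\<forall>j\<le>v. moment c j = \<zero>)}"

lemma point_closed [simp]: "point i \<in> carrier R"
  by (simp add: point_def alpha_closed)

lemma point_n [simp]: "point n = \<zero>"
  by (simp add: point_def)

lemma point_bij: "bij_betw point {..<2 ^ m} (carrier R)"
proof -
  \<comment> \<open>Exponents matter only modulo \<open>n\<close>, so the first \<open>n\<close>
    powers already exhaust the nonzero elements; counting then yields injectivity.\<close>
  have "\<alpha> [^] (k mod n) = \<alpha> [^] k" for k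
  proof -
    have "\<alpha> [^] k = \<alpha> [^] (n * (k div n) + k mod n)" by simp
    also have "\<dots> = (\<alpha> [^] n) [^] (k div n) \<otimes> \<alpha> [^] (k mod n)"
      using alpha_closed by (simp only: nat_pow_mult[symmetric] nat_pow_pow)
    also have "\<alpha> [^] n = \<one>"
    proof -
      have "\<alpha> [^] (1::nat) \<in> carrier R - {\<zero>}" using powers_alpha by blast
      then show ?thesis using alpha_closed by (intro pow_n) auto
    qed
    finally show ?thesis using alpha_closed by simp
  qed
  then have "carrier R - {\<zero>} \<subseteq> point ` {..<2 ^ m}"
    unfolding powers_alpha[symmetric] using n_bounds(1)
    by (fastforce simp: point_def lessThan_eq image_iff intro!: bexI[of _ "_ mod n"])
  moreover have "\<zero> \<in> point ` {..<2 ^ m}" using lessThan_eq point_n by (metis imageI insertI1)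
  ultimately have "point ` {..<2 ^ m} = carrier R" by auto
  moreover from this have "inj_on point {..<2 ^ m}"
    by (intro eq_card_imp_inj_on) (simp_all add: card_carrier)
  ultimately show ?thesis by (simp add: bij_betw_def)
qed

lemma point_eq_iff: "i < 2 ^ m \<Longrightarrow> k < 2 ^ m \<Longrightarrow> point i = point k \<longleftrightarrow> i = k"
  using point_bij by (auto simp: bij_betw_def inj_on_def)

lemma moment_closed [simp]: "moment c j \<in> carrier R"
  by (simp add: moment_def)

lemma moment_add: "moment (\<lambda>i. c i + d i) j = moment c j \<oplus> moment d j"
  unfolding moment_def by (simp add: scale_add_left del: add_bit_eq_xor)

lemma moment_zero: "moment (\<lambda>i. 0) j = \<zero>"
  by (simp add: moment_def)

lemma moment_0_eq: "moment c 0 = bit_scale R (c n + (\<Sum>j<n. c j)) \<one>"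
  unfolding moment_def lessThan_eq
  by (subst finsum_insert) (auto simp: scale_add_left scale_sum simp del: add_bit_eq_xor)

lemma moment_pos_eq:
  assumes "1 \<le> j" "degree p < n" "\<And>i. i < n \<Longrightarrow> c i = coeff p i"
  shows "moment c j = eval_F2 R p (\<alpha> [^] j)"
proof -
  have "moment c j = bit_scale R (c n) (\<zero> [^] j) \<oplus> (\<Oplus>i\<in>{..<n}. bit_scale R (c i) (point i [^] j))"
    unfolding moment_def lessThan_eq by (subst finsum_insert) auto
  \<comment> \<open>The parity coordinate sits at the field's zero and drops out of every moment of
    positive order.\<close>
  also have "\<zero> [^] j = \<zero>" using assms(1) by (simp add: nat_pow_zero)
  also have "(\<Oplus>i\<in>{..<n}. bit_scale R (c i) (point i [^] j))
      = (\<Oplus>i\<in>{..<n}. bit_scale R (coeff p i) ((\<alpha> [^] j) [^] i))"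
    by (rule finsum_cong') (auto simp: assms(3) point_def alpha_closed nat_pow_pow mult.commute)
  finally show ?thesis
    using eval_F2_eq[OF assms(2), of "\<alpha> [^] j"] alpha_closed by simp
qed

lemma scale_one_eq_zero_iff: "bit_scale R b \<one> = \<zero> \<longleftrightarrow> b = 0"
  by (simp add: bit_scale_def)

text \<open>The zeroth moment is the overall parity check. The moments of order 1 to
  \<open>v\<close> are the values of the word's polynomial at the prescribed roots, and their
  vanishing is divisibility by the generator.\<close>

lemma eBCH_eq_moment_code: "eBCH R \<alpha> v m = moment_code v"
proof
  show "eBCH R \<alpha> v m \<subseteq> moment_code v"
  proof
    fix c assume "c \<in> eBCH R \<alpha> v m"
    then obtain p where p: "degree p < n" "BCH_gen R \<alpha> v dvd p"
      and c: "c = (\<lambda>i. if i < n then coeff p i else if i = n then (\<Sum>j<n. coeff p j) else 0)"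
      unfolding eBCH_def BCH_def n_def[symmetric] by auto
    have "c n + (\<Sum>j<n. c j) = 0"
      unfolding bit_add_eq_0_iff by (simp add: c)
    then have "moment c 0 = \<zero>" by (simp only: moment_0_eq scale_zero)
    moreover have "moment c j = \<zero>" if "1 \<le> j" "j \<le> v" for j
      using moment_pos_eq[OF that(1) p(1), of c] p(2) that
      by (simp add: c BCH_gen_dvd_iff has_BCH_roots_def)
    ultimately have "\<forall>j\<le>v. moment c j = \<zero>" by (metis One_nat_def Suc_leI neq0_conv)
    moreover have "\<forall>i\<ge>2 ^ m. c i = 0" using n_bounds by (auto simp: c)
    ultimately show "c \<in> moment_code v" by (simp add: moment_code_def)
  qed
  show "moment_code v \<subseteq> eBCH R \<alpha> v m"
  proof
    fix c assume c: "c \<in> moment_code v"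
    define p where "p = Poly (map c [0..<n])"
    have p: "coeff p i = (if i < n then c i else 0)" for i
      by (simp add: p_def nth_default_def)
    then have deg: "degree p < n"
      using n_bounds(1) by (metis (no_types, lifting) degree_0 leading_coeff_0_iff less_le_trans zero_less_one)
    have "has_BCH_roots R \<alpha> v p"
      unfolding has_BCH_roots_def
      using c moment_pos_eq[OF _ deg, of _ c] p by (auto simp: moment_code_def)
    then have "p \<in> BCH R \<alpha> v m" using deg
      unfolding BCH_def n_def[symmetric] by (simp add: BCH_gen_dvd_iff)
    moreover have "c n = (\<Sum>j<n. c j)"
    proof -
      have "moment c 0 = \<zero>" using c by (simp add: moment_code_def)
      then show ?thesis by (simp only: moment_0_eq scale_one_eq_zero_iff bit_add_eq_0_iff)
    qed
    then have "c = (\<lambda>i. if i < n then coeff p i else if i = n then (\<Sum>j<n. coeff p j) else 0)"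
      using c n_bounds(2) by (auto simp: p moment_code_def fun_eq_iff)
    ultimately show "c \<in> eBCH R \<alpha> v m" unfolding eBCH_def n_def[symmetric] by blast
  qed
qed

section \<open>Linearity and affine invariance\<close>

lemma moment_code_linear: "binary_linear_code (moment_code v) (2 ^ m)"
  by unfold_locales (auto simp: moment_code_def moment_add moment_zero simp del: add_bit_eq_xor)

text \<open>Raising the first factor by one degree splits off one power of \<open>point i\<close> and one scalar,
  which replaces the binomial theorem.\<close>
lemma shifted_moment:
  assumes "c \<in> moment_code v" "b \<in> carrier R" "j + k \<le> v"
  shows "(\<Oplus>i\<in>{..<2 ^ m}. bit_scale R (c i) ((point i \<oplus> b) [^] j \<otimes> point i [^] k)) = \<zero>"
  using assms(3)
proof (induction j arbitrary: k)
  case 0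
  then show ?case using assms(1) by (simp add: moment_code_def moment_def)
next
  case (Suc j)
  let ?t = "\<lambda>j k i. bit_scale R (c i) ((point i \<oplus> b) [^] (j::nat) \<otimes> point i [^] (k::nat))"
  have "?t (Suc j) k i = ?t j (Suc k) i \<oplus> b \<otimes> ?t j k i" for i
  proof -
    let ?y = "point i" and ?q = "(point i \<oplus> b) [^] j"
    have "(?y \<oplus> b) [^] Suc j \<otimes> ?y [^] k = ?q \<otimes> ?y [^] Suc k \<oplus> b \<otimes> (?q \<otimes> ?y [^] k)"
      using assms(2) by (simp add: r_distr l_distr m_ac)
    then show ?thesis
      using assms(2) by (simp add: scale_add_right scale_mult_right del: nat_pow_Suc)
  qed
  then have "(\<Oplus>i\<in>{..<2 ^ m}. ?t (Suc j) k i)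
      = (\<Oplus>i\<in>{..<2 ^ m}. ?t j (Suc k) i) \<oplus> b \<otimes> (\<Oplus>i\<in>{..<2 ^ m}. ?t j k i)"
    using assms(2) by (simp add: finsum_addf finsum_rdistr)
  also have "\<dots> = \<zero>" using Suc.IH[of k] Suc.IH[of "Suc k"] Suc.prems assms(2) by simp
  finally show ?case .
qed

text \<open>Preserving the moment conditions in one direction is enough: relabelling is an injection
  of the finite code into itself, hence onto.\<close>

lemma automorphism_of_bij:
  assumes \<rho>: "bij_betw \<rho> (carrier R) (carrier R)"
    and inv: "\<And>c j. c \<in> moment_code v \<Longrightarrow> j \<le> v
      \<Longrightarrow> (\<Oplus>i\<in>{..<2 ^ m}. bit_scale R (c i) (\<rho> (point i) [^] j)) = \<zero>"
  obtains \<pi> where "code_automorphism (moment_code v) (2 ^ m) \<pi>"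
    "\<And>i. i < 2 ^ m \<Longrightarrow> \<pi> i < 2 ^ m \<and> point (\<pi> i) = \<rho> (point i)"
proof -
  let ?A = "{..<2 ^ m} :: nat set" and ?W = "moment_code v"
  define \<pi> where "\<pi> i = (if i \<in> ?A then inv_into ?A point (\<rho> (point i)) else i)" for i
  have "bij_betw (inv_into ?A point \<circ> (\<rho> \<circ> point)) ?A ?A"
    by (intro bij_betw_trans[OF bij_betw_trans[OF point_bij \<rho>]] bij_betw_inv_into point_bij)
  then have bij: "bij_betw \<pi> ?A ?A"
    by (rule bij_betw_cong[THEN iffD1, rotated]) (simp add: \<pi>_def)
  then have perm: "\<pi> permutes ?A"
    by (rule bij_imp_permutes) (simp add: \<pi>_def)
  have \<pi>: "\<pi> i < 2 ^ m \<and> point (\<pi> i) = \<rho> (point i)" if "i < 2 ^ m" for i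
  proof
    show "\<pi> i < 2 ^ m" using bij that by (auto simp: bij_betw_def)
    have "\<rho> (point i) \<in> point ` ?A" using \<rho> point_bij by (auto simp: bij_betw_def)
    then show "point (\<pi> i) = \<rho> (point i)" using that by (simp add: \<pi>_def f_inv_into_f)
  qed
  define \<sigma> where "\<sigma> = inv_into UNIV \<pi>"
  have \<sigma>: "\<sigma> permutes ?A" "\<pi> \<circ> \<sigma> = id" "\<sigma> \<circ> \<pi> = id"
    using perm unfolding \<sigma>_def by (auto simp: permutes_inv permutes_inv_o)
  have closed: "c \<circ> \<sigma> \<in> ?W" if c: "c \<in> ?W" for c
  proof -
    have "moment (c \<circ> \<sigma>) j = \<zero>" if "j \<le> v" for j
    proof -
      let ?f = "\<lambda>i. bit_scale R (c (\<sigma> i)) (point i [^] j)"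
      \<comment> \<open>Reindexing by \<pi> undoes \<sigma> in the word and moves each label by
        \<rho>.\<close>
      have "finsum R ?f (\<pi> ` ?A) = finsum R (\<lambda>i. ?f (\<pi> i)) ?A"
        by (rule finsum_reindex) (use bij in \<open>auto simp: bij_betw_def\<close>)
      also have "\<dots> = (\<Oplus>i\<in>?A. bit_scale R (c i) (\<rho> (point i) [^] j))"
      proof (rule finsum_cong')
        show "(\<lambda>i. bit_scale R (c i) (\<rho> (point i) [^] j)) \<in> ?A \<rightarrow> carrier R"
          using \<rho> by (auto simp: bij_betw_def intro!: scale_closed nat_pow_closed)
        show "?f (\<pi> i) = bit_scale R (c i) (\<rho> (point i) [^] j)" if "i \<in> ?A" for i
          using \<pi> that \<sigma>(3) by (simp add: fun_eq_iff)
      qed simp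
      also have "\<dots> = \<zero>" using inv c that by blast
      finally show ?thesis using bij by (simp add: moment_def bij_betw_def)
    qed
    moreover have "\<forall>i\<ge>2 ^ m. (c \<circ> \<sigma>) i = 0"
      using c \<sigma>(1) by (simp add: moment_code_def permutes_def)
    ultimately show ?thesis by (simp add: moment_code_def)
  qed
  have inj: "inj_on (\<lambda>c. c \<circ> \<sigma>) ?W"
    by (rule inj_onI) (metis \<sigma>(3) comp_assoc comp_id)
  have surj: "(\<lambda>c. c \<circ> \<sigma>) ` ?W = ?W"
    using closed inj binary_linear_code.finite_code[OF moment_code_linear]
    by (intro endo_inj_surj) auto
  have pull: "c \<circ> \<pi> \<in> ?W" if "c \<in> ?W" for c
  proof -
    from that have "c \<in> (\<lambda>c. c \<circ> \<sigma>) ` ?W" by (simp only: surj)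
    then obtain d where "d \<in> ?W" "c = d \<circ> \<sigma>" by (elim imageE)
    then show ?thesis using \<sigma>(3) by (simp add: comp_assoc)
  qed
  have push: "c \<in> ?W" if "c \<circ> \<pi> \<in> ?W" for c
    using closed[OF that] \<sigma>(2) by (simp add: comp_assoc)
  have "code_automorphism ?W (2 ^ m) \<pi>"
    unfolding code_automorphism_def by (intro conjI allI iffI perm) (fact push, fact pull)
  then show ?thesis using \<pi> by (rule that)
qed

text \<open>The base point is the parity coordinate, labelled by zero. Translations carry zero to
  any label; multiplications by units fix zero and carry any nonzero label to any other.\<close>

lemma moment_code_two_transitive: "two_transitive_code (moment_code v) (2 ^ m) n"
proof (intro two_transitive_code.intro two_transitive_code_axioms.intro moment_code_linear)
  show n: "n < 2 ^ m" using n_bounds by simp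
  show "\<exists>\<pi>. code_automorphism (moment_code v) (2 ^ m) \<pi> \<and> \<pi> n = i" if i: "i < 2 ^ m" for i
  proof -
    let ?b = "point i"
    have bij: "bij_betw (\<lambda>x. x \<oplus> ?b) (carrier R) (carrier R)"
      by (rule bij_betw_byWitness[where f' = "\<lambda>x. x \<oplus> ?b"])
        (auto simp: a_assoc add_self)
    have "(\<Oplus>l\<in>{..<2 ^ m}. bit_scale R (c l) ((point l \<oplus> ?b) [^] j)) = \<zero>"
      if "c \<in> moment_code v" "j \<le> v" for c j
      using shifted_moment[OF that(1), of ?b j 0] that(2) by simp
    from automorphism_of_bij[OF bij this] obtain \<pi> where
      \<pi>: "code_automorphism (moment_code v) (2 ^ m) \<pi>"
        "\<And>i. i < 2 ^ m \<Longrightarrow> \<pi> i < 2 ^ m \<and> point (\<pi> i) = point i \<oplus> ?b" by blast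
    have "point (\<pi> n) = point i" "\<pi> n < 2 ^ m" using \<pi>(2)[OF n] by simp_all
    then show ?thesis using \<pi>(1) point_eq_iff i by blast
  qed
  show "\<exists>\<pi>. code_automorphism (moment_code v) (2 ^ m) \<pi> \<and> \<pi> n = n \<and> \<pi> j = k"
    if jk: "j < 2 ^ m" "k < 2 ^ m" "j \<noteq> n" "k \<noteq> n" for j k
  proof -
    have nz: "point j \<in> Units R" "point k \<in> Units R"
      using point_eq_iff[OF jk(1) n] point_eq_iff[OF jk(2) n] jk by (auto simp: field_Units)
    define a where "a = point k \<otimes> inv (point j)"
    have a: "a \<in> Units R" unfolding a_def using nz by simp
    have bij: "bij_betw (\<lambda>x. a \<otimes> x) (carrier R) (carrier R)"
      by (rule bij_betw_byWitness[where f' = "\<lambda>x. inv a \<otimes> x"])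
        (use a Units_closed[OF a] in \<open>auto simp: m_assoc[symmetric]\<close>)
    have "(\<Oplus>l\<in>{..<2 ^ m}. bit_scale R (c l) ((a \<otimes> point l) [^] i)) = \<zero>"
      if "c \<in> moment_code v" "i \<le> v" for c i
    proof -
      have "(\<Oplus>l\<in>{..<2 ^ m}. bit_scale R (c l) ((a \<otimes> point l) [^] i)) = a [^] i \<otimes> moment c i"
        using Units_closed[OF a]
        by (simp add: moment_def nat_pow_distrib scale_mult_right finsum_rdistr)
      then show ?thesis using that Units_closed[OF a] by (simp add: moment_code_def)
    qed
    from automorphism_of_bij[OF bij this] obtain \<pi> where
      \<pi>: "code_automorphism (moment_code v) (2 ^ m) \<pi>"
        "\<And>i. i < 2 ^ m \<Longrightarrow> \<pi> i < 2 ^ m \<and> point (\<pi> i) = a \<otimes> point i" by blast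
    have "point (\<pi> n) = point n" "\<pi> n < 2 ^ m" using \<pi>(2)[OF n] Units_closed[OF a] by simp_all
    then have "\<pi> n = n" using point_eq_iff n by blast
    moreover have "point (\<pi> j) = point k" "\<pi> j < 2 ^ m"
      using \<pi>(2)[OF jk(1)] nz Units_closed[OF nz(2)] by (simp_all add: a_def m_assoc)
    then have "\<pi> j = k" using point_eq_iff jk by blast
    ultimately show ?thesis using \<pi>(1) by blast
  qed
qed

section \<open>Counting dimensions and tuning the rate\<close>

lemma card_moment_kernel:
  assumes "binary_linear_code A N"
  shows "card A \<le> 2 ^ m * card {c \<in> A. moment c j = \<zero>}"
proof -
  interpret binary_linear_code A N by fact
  let ?K = "{c \<in> A. moment c j = \<zero>}"
  \<comment> \<open>The moment map is additive, so adding a fixed word of a nonempty fibre maps that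
    fibre injectively into the kernel.\<close>
  have fiber: "card {c \<in> A. moment c j = y} \<le> card ?K" for y
  proof (cases "{c \<in> A. moment c j = y} = {}")
    case False
    then obtain d where d: "d \<in> A" "moment d j = y" by auto
    have "inj_on (\<lambda>c i. c i + d i) {c \<in> A. moment c j = y}"
      by (rule inj_onI) (metis (no_types) bit_add_cancel_right ext)
    moreover have "(\<lambda>c i. c i + d i) ` {c \<in> A. moment c j = y} \<subseteq> ?K"
      using d add add_self[of "moment d j"] by (auto simp: moment_add simp del: add_bit_eq_xor)
    ultimately show ?thesis by (rule card_inj_on_le) (simp add: finite_code)
  next
    case True
    then show ?thesis by (simp only: card.empty)
  qed
  have "A = (\<Union>y\<in>carrier R. {c \<in> A. moment c j = y})" by auto
  then have "card A \<le> (\<Sum>y\<in>carrier R. card {c \<in> A. moment c j = y})"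
    using card_UN_le[OF finite_carrier, of "\<lambda>y. {c \<in> A. moment c j = y}"] by simp
  also have "\<dots> \<le> (\<Sum>y\<in>carrier R. card ?K)" by (rule sum_mono) (rule fiber)
  finally show ?thesis by (simp add: card_carrier)
qed

lemma moment_code_Suc: "moment_code (Suc v) = {c \<in> moment_code v. moment c (Suc v) = \<zero>}"
  by (auto simp: moment_code_def le_Suc_eq)

lemma card_moment_code_Suc: "card (moment_code v) \<le> 2 ^ m * card (moment_code (Suc v))"
  unfolding moment_code_Suc by (rule card_moment_kernel[OF moment_code_linear])

text \<open>The parity check costs a single bit, but the general allowance of \<open>m\<close> bits
  per moment is accurate enough for the rate.\<close>

lemma card_moment_code_0: "2 ^ 2 ^ m \<le> 2 ^ m * card (moment_code 0)"
proof -
  have "binary_linear_code {c. \<forall>i\<ge>2 ^ m. c i = 0} (2 ^ m)" by unfold_locales auto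
  note card_moment_kernel[OF this, of 0]
  moreover have "{c \<in> {c. \<forall>i\<ge>2 ^ m. c i = 0}. moment c 0 = \<zero>} = moment_code 0"
    by (auto simp: moment_code_def)
  ultimately show ?thesis by (simp only: card_words)
qed

text \<open>The function \<open>x \<mapsto> 1 + (x + a)^n\<close> is the indicator of \<open>a\<close>.\<close>
lemma moment_code_n: "moment_code n = {\<lambda>_. 0}"
proof -
  have "c i = 0" if c: "c \<in> moment_code n" for c i
  proof (cases "i < 2 ^ m")
    case True
    have ind: "(point l \<oplus> point i) [^] n \<oplus> \<one> = (if i = l then \<one> else \<zero>)" if "l < 2 ^ m" for l
    proof (cases "i = l")
      case True
      then show ?thesis using n_bounds(1) by (simp add: add_self nat_pow_zero)
    next
      case False
      have "point l \<oplus> point i \<noteq> \<zero>"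
      proof
        assume "point l \<oplus> point i = \<zero>"
        then have "(point l \<oplus> point i) \<oplus> point i = point i" by simp
        then have "point l = point i" by (simp add: a_assoc add_self)
        then show False using False point_eq_iff[OF that \<open>i < 2 ^ m\<close>] by simp
      qed
      then show ?thesis using False by (simp add: pow_n add_self)
    qed
    \<comment> \<open>Both sums vanish, being shifted moments with exponents \<open>n\<close> and 0;
      together they pick out the value of \<open>c\<close> at \<open>i\<close>.\<close>
    have "\<zero> = (\<Oplus>l\<in>{..<2 ^ m}. bit_scale R (c l) ((point l \<oplus> point i) [^] n))
        \<oplus> (\<Oplus>l\<in>{..<2 ^ m}. bit_scale R (c l) \<one>)"
      using shifted_moment[OF c, of "point i" n 0] shifted_moment[OF c, of "point i" 0 0] by simp
    also have "\<dots> = (\<Oplus>l\<in>{..<2 ^ m}. bit_scale R (c l) ((point l \<oplus> point i) [^] n \<oplus> \<one>))"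
      by (simp add: scale_add_right finsum_addf)
    also have "\<dots> = (\<Oplus>l\<in>{..<2 ^ m}. if i = l then bit_scale R (c l) \<one> else \<zero>)"
      by (rule finsum_cong') (auto simp: ind)
    also have "\<dots> = bit_scale R (c i) \<one>"
      using True by (intro add.finprod_singleton) auto
    finally have "bit_scale R (c i) \<one> = \<zero>" by (rule sym)
    then show ?thesis by (simp only: scale_one_eq_zero_iff)
  qed (use c in \<open>simp add: moment_code_def\<close>)
  moreover have "(\<lambda>_. 0) \<in> moment_code n" by (simp add: moment_code_def moment_zero)
  ultimately show ?thesis by auto
qed

text \<open>The rate starts near 1, ends at 0, and drops by at most m / 2^m per step, so the first
  \<open>v\<close> with rate at most \<open>r\<close> overshoots by at most one step.\<close>

lemma ex_rate_near:
  assumes "0 < r"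
  shows "\<exists>v. 1 \<le> v \<and> v \<le> 2 ^ m - 1 \<and> code_rate (eBCH R \<alpha> v m) (2 ^ m) \<le> r \<and>
    min (r - real m / 2 ^ m) (1 - 2 * (real m / 2 ^ m)) \<le> code_rate (eBCH R \<alpha> v m) (2 ^ m)"
proof -
  define q where "q v = code_rate (moment_code v) (2 ^ m)" for v
  have pos: "0 < card (moment_code v)" for v
    using binary_linear_code.finite_code[OF moment_code_linear]
      binary_linear_code.zero[OF moment_code_linear] by (auto simp: card_gt_0_iff)
  have lg: "log 2 (2 ^ m * card (moment_code v)) = real m + log 2 (card (moment_code v))" for v
    using pos[of v] by (simp add: log_mult)
  have step: "q v - real m / 2 ^ m \<le> q (Suc v)" for v
  proof -
    have "real (card (moment_code v)) \<le> 2 ^ m * real (card (moment_code (Suc v)))"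
      using card_moment_code_Suc[of v] by (metis of_nat_le_iff of_nat_mult of_nat_numeral of_nat_power)
    then have "log 2 (card (moment_code v)) \<le> log 2 (2 ^ m * card (moment_code (Suc v)))"
      using pos[of v] by simp
    then have "log 2 (card (moment_code v)) / 2 ^ m
        \<le> (real m + log 2 (card (moment_code (Suc v)))) / 2 ^ m"
      unfolding lg by (intro divide_right_mono) auto
    then show ?thesis unfolding q_def code_rate_def by (simp add: add_divide_distrib)
  qed
  have q0: "1 - real m / 2 ^ m \<le> q 0"
  proof -
    have "(2::real) ^ 2 ^ m \<le> 2 ^ m * real (card (moment_code 0))"
      using of_nat_mono[OF card_moment_code_0, where 'a=real]
      by (simp only: of_nat_mult of_nat_power of_nat_numeral)
    then have "log 2 (2 ^ 2 ^ m) \<le> log 2 (2 ^ m * card (moment_code 0))"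
      by (subst log_le_cancel_iff) (use pos[of 0] in auto)
    then have "2 ^ m / 2 ^ m \<le> (real m + log 2 (card (moment_code 0))) / 2 ^ m"
      unfolding lg by (intro divide_right_mono) auto
    then show ?thesis unfolding q_def code_rate_def by (simp add: add_divide_distrib)
  qed
  define v where "v = (LEAST v. 1 \<le> v \<and> q v \<le> r)"
  have qn: "1 \<le> n \<and> q n \<le> r"
    using n_bounds(1) assms by (simp add: q_def code_rate_def moment_code_n)
  then have v: "1 \<le> v \<and> q v \<le> r" unfolding v_def by (rule LeastI)
  have "v \<le> n" unfolding v_def using qn by (rule Least_le)
  moreover have "min (r - real m / 2 ^ m) (1 - 2 * (real m / 2 ^ m)) \<le> q v"
  \<comment> \<open>If the search stops at once there is no preceding value above \<open>r\<close>.
    The rate is then bounded by two steps down from 1, which is the second entry of the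
    minimum.\<close>
  proof (cases "v = 1")
    case True
    then show ?thesis using step[of 0] q0 by simp
  next
    case False
    then have "\<not> (1 \<le> v - 1 \<and> q (v - 1) \<le> r)" unfolding v_def by (intro not_less_Least) (use v v_def in auto)
    then have "r < q (v - 1)" using False v by auto
    then show ?thesis using step[of "v - 1"] v by simp
  qed
  ultimately show ?thesis using v unfolding q_def eBCH_eq_moment_code n_def by blast
qed

end

section \<open>Extended BCH codes achieve capacity\<close>

theorem theorem8:
  fixes F :: "nat \<Rightarrow> ('a, 'b) ring_scheme" and \<alpha> :: "nat \<Rightarrow> 'a" and r :: real
  assumes fields: "\<And>m. m \<ge> 1 \<Longrightarrow> field (F m) \<and> finite (carrier (F m)) \<and>
                        card (carrier (F m)) = 2 ^ m"
    and prim: "\<And>m. m \<ge> 1 \<Longrightarrow> primitive_elem (F m) (\<alpha> m)"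
    and r: "0 < r" "r < 1"
  shows "\<exists>v :: nat \<Rightarrow> nat.
           (\<forall>m\<ge>1. 1 \<le> v m \<and> v m \<le> 2 ^ m - 1) \<and>
           ((\<lambda>m. code_rate (eBCH (F m) (\<alpha> m) (v m) m) (2 ^ m)) \<longlonglongrightarrow> r) \<and>
           (\<forall>p. 0 \<le> p \<and> p < 1 - r \<longrightarrow>
              ((\<lambda>m. bit_MAP_error (eBCH (F m) (\<alpha> m) (v m) m) (2 ^ m) p) \<longlonglongrightarrow> 0))"
proof -
  have BCH: "BCH_field (F m) m (\<alpha> m)" if "m \<ge> 1" for m
    using fields[OF that] prim[OF that] that by (simp add: BCH_field_def BCH_field_axioms_def)
  let ?rate = "\<lambda>m v. code_rate (eBCH (F m) (\<alpha> m) v m) (2 ^ m)"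
  let ?low = "\<lambda>m. min (r - real m / 2 ^ m) (1 - 2 * (real m / 2 ^ m))"
  have "\<forall>m\<ge>1. \<exists>v. 1 \<le> v \<and> v \<le> 2 ^ m - 1 \<and> ?rate m v \<le> r \<and> ?low m \<le> ?rate m v"
    using BCH_field.ex_rate_near[OF BCH r(1)] by blast
  then obtain v where v: "1 \<le> v m" "v m \<le> 2 ^ m - 1" "?rate m (v m) \<le> r" "?low m \<le> ?rate m (v m)"
    if "m \<ge> 1" for m by metis
  \<comment> \<open>Nothing is assumed about the structure at \<open>m = 0\<close>, so the limits
    are taken through eventual statements.\<close>
  have ev: "\<forall>\<^sub>F m in sequentially. m \<ge> (1::nat)" by (rule eventually_ge_at_top)
  have "(\<lambda>m. real m / 2 ^ m) \<longlonglongrightarrow> 0"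
    using powser_times_n_limit_0[of "1 / 2 :: real"] by (simp add: power_one_over)
  \<comment> \<open>Since r < 1, the minimum of \<open>r\<close> and 1 in the limit is
    \<open>r\<close>, and the rates are squeezed between \<open>?low\<close> and
    \<open>r\<close>.\<close>
  then have "?low \<longlonglongrightarrow> min (r - 0) (1 - 2 * 0)"
    by (intro tendsto_intros)
  then have "?low \<longlonglongrightarrow> r" using r by simp
  then have rate: "(\<lambda>m. ?rate m (v m)) \<longlonglongrightarrow> r"
    by (rule tendsto_sandwich[rotated 2, OF _ tendsto_const])
      (rule eventually_mono[OF ev], rule v, assumption)+
  have "(\<lambda>m. bit_MAP_error (eBCH (F m) (\<alpha> m) (v m) m) (2 ^ m) p) \<longlonglongrightarrow> 0"
    if "0 \<le> p" "p < 1 - r" for p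
  proof (rule two_transitive_codes_bit_MAP_error_tendsto_0[OF _ _ rate r(1) that])
    show "\<forall>\<^sub>F m in sequentially. two_transitive_code (eBCH (F m) (\<alpha> m) (v m) m) (2 ^ m) (2 ^ m - 1)"
      using ev
    proof eventually_elim
      case (elim m)
      interpret BCH_field "F m" m "\<alpha> m" by (rule BCH[OF elim])
      show ?case unfolding eBCH_eq_moment_code by (rule moment_code_two_transitive[unfolded n_def])
    qed
    show "filterlim (\<lambda>m. 2 ^ m :: nat) at_top sequentially"
      by (rule filterlim_subseq) (simp add: strict_mono_def)
  qed
  then show ?thesis using v rate by blast
qed

end
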